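(* Let $(W,S)$ be a Coxeter system of type $B_n$, $n\ge2$. As a $\mathbb{Q}$-algebra, $\mathfrak{E}(W)=\mathbb{Q}[x_{n-1}]$ is isomorphic to $\mathbb{Q}[x]/(x^{\underline{n+1}})$, via an isomorphism sending $x_{n-1}$ to the coset of $2x^{\underline{1}}$. Its $\mathbb{Q}$-bases $\{x_0,x_1,\dots,x_n\}$ and $\{x_{n-1}^0,\dots,x_{n-1}^n\}$ are related by the base change formulas $$x_{n-k}=\sum_{m=0}^k(-2)^{k-m}\genfrac{[}{]}{0pt}{}{k}{m}\,x_{n-1}^m\quad\text{and}\quad x_{n-1}^k=\sum_{m=0}^k\genfrac{\{}{\}}{0pt}{}{k}{m}\,2^{k-m}\,x_{n-m},$$ for $0\le k\le n$.
   Context: For a finite Coxeter system $(W,S)$ with length function $\ell$ and $J\subseteq S$, let $X_J=\{w\in W: \ell(ws)>\ell(w)\text{ for all } s\in J\}$ and $x_J=\sum_{w\in X_J} w$ in the group algebra $\mathbb{Q}W$. For type $B_n$ label $S=\{s_1,\dots,s_n\}$ so that $s_1s_2$ has order $4$, $s_is_{i+1}$ has order $3$ for $2\le i\le n-1$, and all other pairs of distinct generators commute. For $0\le j\le n$ put $x_j=x_{\{s_1,\dots,s_j\}}$ (so $x_n=1$). $\mathfrak{E}(W)=\mathbb{Q}[x_{n-1}]$ is the unital subalgebra of $\mathbb{Q}W$ generated by $x_{n-1}$. The falling power is $x^{\underline{k}}=\prod_{i=0}^{k-1}(x-i)$, so $x^{\underline{1}}=x$. $\genfrac{[}{]}{0pt}{}{k}{m}$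 is the (unsigned) Stirling number of the first kind (number of ways to arrange $k$ elements in $m$ cycles), and $\genfrac{\{}{\}}{0pt}{}{k}{m}$ is the Stirling number of the second kind (number of partitions of a $k$-element set into $m$ nonempty subsets). *)

theory Defs
  imports
    "HOL-Library.Poly_Mapping"
    "HOL-Computational_Algebra.Polynomial"
    "HOL-Combinatorics.Stirling"
    "HOL-Algebra.Algebraic_Closure_Type"
begin

section \<open>Coxeter systems\<close>

text \<open>
  A group \<open>W\<close> is a type of class \<^class>\<open>group_add\<close>, i.e. an arbitrary, not necessarily
  commutative group written additively. The product of a word of generators is
  then \<^const>\<open>sum_list\<close>, and \<open>s + t\<close> is the product usually written \<open>st\<close>.
\<close>

text \<open>The order of a group element, with \<open>0\<close> standing for infinite order.\<close>

definition elt_order :: "'w::group_add \<Rightarrow> nat" where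
  "elt_order g =
    (if \<exists>k>0. sum_list (replicate k g) = 0
     then LEAST k. k > 0 \<and> sum_list (replicate k g) = 0 else 0)"

text \<open>
  Equality of words over \<open>S\<close> in the group presented by the generators \<open>S\<close> and the
  relations \<open>(st)^m(s,t) = 1\<close>, where \<open>m(s,t)\<close> is the order of \<open>st\<close> in \<open>W\<close>. A pair of infinite
  order contributes no relation, its relator being the empty word. For involutions
  the relators with \<open>s = t\<close> are \<open>ss\<close>, so words in the generators alone, without formal
  inverses, suffice.
\<close>

inductive cox_equiv :: "'w::group_add set \<Rightarrow> 'w list \<Rightarrow> 'w list \<Rightarrow> bool" for S where
  refl: "u \<in> lists S \<Longrightarrow> cox_equiv S u u"
| sym: "cox_equiv S u v \<Longrightarrow> cox_equiv S v u"
| trans: "cox_equiv S u v \<Longrightarrow> cox_equiv S v w \<Longrightarrow> cox_equiv S u w"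
| relator: "u \<in> lists S \<Longrightarrow> v \<in> lists S \<Longrightarrow> s \<in> S \<Longrightarrow> t \<in> S \<Longrightarrow>
    cox_equiv S (u @ concat (replicate (elt_order (s + t)) [s, t]) @ v) (u @ v)"

definition coxeter_system :: "'w::group_add set \<Rightarrow> bool" where
  "coxeter_system S \<longleftrightarrow>
     (\<forall>s\<in>S. s \<noteq> 0 \<and> s + s = 0) \<and>
     (\<forall>w. \<exists>u\<in>lists S. sum_list u = w) \<and>
     (\<forall>u\<in>lists S. \<forall>v\<in>lists S. sum_list u = sum_list v \<longleftrightarrow> cox_equiv S u v)"

text \<open>The generators are labelled \<open>s 1, \<dots>, s n\<close>; other values of \<open>s\<close> are irrelevant.\<close>

definition coxeter_system_type_B :: "nat \<Rightarrow> (nat \<Rightarrow> 'w::group_add) \<Rightarrow> bool" where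
  "coxeter_system_type_B n s \<longleftrightarrow>
     coxeter_system (s ` {1..n}) \<and> inj_on s {1..n} \<and>
     elt_order (s 1 + s 2) = 4 \<and>
     (\<forall>i\<in>{2..n-1}. elt_order (s i + s (i + 1)) = 3) \<and>
     (\<forall>i\<in>{1..n}. \<forall>j\<in>{1..n}. i + 1 < j \<longrightarrow> s i + s j = s j + s i)"

definition cox_length :: "'w::group_add set \<Rightarrow> 'w \<Rightarrow> nat" where
  "cox_length S w = (LEAST k. \<exists>u\<in>lists S. length u = k \<and> sum_list u = w)"

definition cox_X :: "'w::group_add set \<Rightarrow> 'w set \<Rightarrow> 'w set" where
  "cox_X S J = {w. \<forall>s\<in>J. cox_length S (w + s) > cox_length S w}"


section \<open>The group algebra\<close>

text \<open>
  The group algebra \<open>\<rat>W\<close> is the type \<open>'w \<Rightarrow>\<^sub>0 rat\<close> with its convolution product; the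
  basis element of \<open>w\<close> is \<open>Poly_Mapping.single w 1\<close>.
\<close>

definition cox_x :: "'w::group_add set \<Rightarrow> 'w set \<Rightarrow> 'w \<Rightarrow>\<^sub>0 rat" where
  "cox_x S J = (\<Sum>w\<in>cox_X S J. Poly_Mapping.single w 1)"

definition type_B_x :: "nat \<Rightarrow> (nat \<Rightarrow> 'w::group_add) \<Rightarrow> nat \<Rightarrow> 'w \<Rightarrow>\<^sub>0 rat" where
  "type_B_x n s j = cox_x (s ` {1..n}) (s ` {1..j})"

definition qscale :: "rat \<Rightarrow> ('w \<Rightarrow>\<^sub>0 rat) \<Rightarrow> ('w \<Rightarrow>\<^sub>0 rat)" where
  "qscale c a = Poly_Mapping.map ((*) c) a"

lemma lookup_qscale: "Poly_Mapping.lookup (qscale c a) w = c * Poly_Mapping.lookup a w"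
  unfolding qscale_def by (simp add: Poly_Mapping.map.rep_eq when_def)

global_interpretation group_algebra: vector_space "qscale :: rat \<Rightarrow> ('w \<Rightarrow>\<^sub>0 rat) \<Rightarrow> _"
  by standard (auto intro!: poly_mapping_eqI simp: lookup_qscale lookup_add algebra_simps)

definition unital_subalgebra :: "('w::group_add \<Rightarrow>\<^sub>0 rat) set \<Rightarrow> bool" where
  "unital_subalgebra A \<longleftrightarrow>
     group_algebra.subspace A \<and> 1 \<in> A \<and> (\<forall>a\<in>A. \<forall>b\<in>A. a * b \<in> A)"

text \<open>The unital subalgebra \<open>\<rat>[a]\<close> generated by \<open>a\<close>.\<close>

definition gen_subalgebra :: "('w::group_add \<Rightarrow>\<^sub>0 rat) \<Rightarrow> ('w \<Rightarrow>\<^sub>0 rat) set" where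
  "gen_subalgebra a = unital_subalgebra hull {a}"

text \<open>
  The family \<open>b 0, \<dots>, b n\<close> is a basis of the subspace \<open>V\<close>. Injectivity excludes
  repetitions, which the independence of the underlying set does not see.
\<close>

definition family_basis ::
    "(nat \<Rightarrow> 'w \<Rightarrow>\<^sub>0 rat) \<Rightarrow> nat \<Rightarrow> ('w \<Rightarrow>\<^sub>0 rat) set \<Rightarrow> bool" where
  "family_basis b n V \<longleftrightarrow>
     inj_on b {..n} \<and> group_algebra.independent (b ` {..n}) \<and>
     group_algebra.span (b ` {..n}) = V"


section \<open>Quotients of the polynomial ring\<close>

definition falling_power :: "'a::comm_ring_1 \<Rightarrow> nat \<Rightarrow> 'a" where
  "falling_power x k = (\<Prod>i<k. x - of_nat i)"

abbreviation polyQ :: "rat poly ring" where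
  "polyQ \<equiv> ring_of_type_algebra"

text \<open>
  A ring isomorphism from the subalgebra \<open>E\<close> of \<open>\<rat>W\<close> onto \<open>\<rat>[x]/(f)\<close> that is
  \<open>\<rat>\<close>-linear for the scalar multiplication \<open>c (p + (f)) = c p + (f)\<close> of cosets.
\<close>

definition algebra_iso_quotient ::
    "('w::group_add \<Rightarrow>\<^sub>0 rat) set \<Rightarrow> rat poly \<Rightarrow> (('w \<Rightarrow>\<^sub>0 rat) \<Rightarrow> rat poly set) \<Rightarrow> bool" where
  "algebra_iso_quotient E f \<phi> \<longleftrightarrow>
     \<phi> \<in> ring_iso (ring_of_type_algebra\<lparr>carrier := E\<rparr>) (polyQ Quot (PIdl\<^bsub>polyQ\<^esub> f)) \<and>
     (\<forall>a\<in>E. \<forall>c p. \<phi> a = (PIdl\<^bsub>polyQ\<^esub> f) +>\<^bsub>polyQ\<^esub> p \<longrightarrow>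
        \<phi> (qscale c a) = (PIdl\<^bsub>polyQ\<^esub> f) +>\<^bsub>polyQ\<^esub> smult c p)"

end

(* A word in W acts by signed permutations, and the sets D m of minimal representatives of the
   left cosets of <s_1, ..., s_(m-1)> in <s_1, ..., s_m> satisfy
   D m = {1} Un D (m-1) s_m Un {t_m}, where t_m is the sign change of the last coordinate.
   They show that the action is faithful, so that length is read off from descents of signed
   permutations, and that x_j = d_n d_(n-1) ... d_(j+1) with d_m the sum of D m.
   The recursion for D m gives d_m^2 = d_m d_(m-1) + 2 d_m, hence
   x_(n-1) x_(n-k) = x_(n-k-1) + 2 k x_(n-k): up to powers of 2, the x_(n-k) are the falling powers
   of x_(n-1) / 2. The Stirling recursions give the base changes, and the linear independence
   of the x_j shows that the falling power of degree n + 1 is the minimal polynomial. *)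

theory Submission
  imports Defs
begin

section \<open>Signed permutations\<close>

text \<open>Only the presentation is given: length is a minimum over words, and finiteness of W is
  not assumed. This forces the order of the arguments. Before the action is known to be faithful,
  identities in W must come from the Coxeter relations: the commutation of t_m with s_i for i < m,
  and the closure of D m <s_1, ..., s_(m-1)> under left multiplication. Afterwards the exchange
  property can be checked by comparing signed permutations. The order 4 relation enters computations
  inside W only through s_1 t_2 = t_2 s_1; elsewhere the convention that D 0 is empty removes the
  pair s_1, s_2. The 2 in the quadratic relation counts the elements 1 and t_m of D m, because d_m
  t_m = d_m. Expanding the second factor of d_m d_m shows that the relation amounts to d_m d_(m-1)
  s_m = d_m d_(m-1).\<close>

lemma sum_list_replicate_elt_order: "sum_list (replicate (elt_order g) g) = 0"
proof (cases "\<exists>k>0. sum_list (replicate k g) = 0")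
  case True
  then show ?thesis
    unfolding elt_order_def if_P[OF True]
    using LeastI_ex[of "\<lambda>k. k > 0 \<and> sum_list (replicate k g) = 0"] by blast
next
  case False
  then show ?thesis unfolding elt_order_def if_not_P[OF False] by simp
qed

lemma elt_order_eqI:
  assumes "k > 0" "sum_list (replicate k g) = 0"
    and "\<And>j. 0 < j \<Longrightarrow> j < k \<Longrightarrow> sum_list (replicate j g) \<noteq> 0"
  shows "elt_order g = k"
proof -
  have "(LEAST k. k > 0 \<and> sum_list (replicate k g) = 0) = k"
    using assms by (intro Least_equality) (auto simp: not_less[symmetric])
  then show ?thesis using assms by (auto simp: elt_order_def)
qed

lemma sum_list_replicate_uminus:
  fixes g :: "'w::group_add"
  shows "sum_list (replicate k (- g)) = - sum_list (replicate k g)"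
proof (induction k)
  case (Suc k)
  have "g + sum_list (replicate k g) = sum_list (replicate k g) + g"
    by (induction k) (simp, metis add.assoc replicate_Suc sum_list.Cons)
  with Suc show ?case by (metis minus_add replicate_Suc sum_list.Cons)
qed simp

lemma elt_order_uminus: "elt_order (- g) = elt_order (g :: 'w::group_add)"
  unfolding elt_order_def sum_list_replicate_uminus neg_equal_0_iff_equal ..

text \<open>Signed permutations act on the integers with negation \<open>x \<mapsto> -1 - x\<close>, so that
  the signed coordinates \<open>\<pm>1, \<dots>, \<pm>m\<close> become the interval \<open>{-m..m-1}\<close>, and the
  generator \<open>k\<close> exchanges \<open>k - 2\<close> with \<open>k - 1\<close> and \<open>-k\<close> with \<open>1 - k\<close>,
  uniformly in \<open>k \<ge> 1\<close>.\<close>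

definition refl_B :: "int \<Rightarrow> int \<Rightarrow> int" where
  "refl_B k x = (if x = k - 1 \<or> x = 1 - k then x - 1
                 else if x = k - 2 \<or> x = - k then x + 1 else x)"

definition cox_entry_B :: "nat \<Rightarrow> nat \<Rightarrow> nat" where
  "cox_entry_B i j = (if i = j then 1 else if i = j + 1 \<or> j = i + 1
     then (if i = 1 \<or> j = 1 then 4 else 3) else 2)"

lemma refl_B_invol:
  assumes "k \<ge> 1"
  shows "refl_B k (refl_B k x) = x"
proof -
  \<comment> \<open>The exchanged pairs {k-2, k-1} and {-k, 1-k} coincide for k = 1. For k > 1 the
    only possible overlap is k-2 = 1-k, which parity excludes.\<close>
  have odd: "2 * k \<noteq> 3" by presburger
  consider "x = k - 2" | "x = k - 1" | "x = - k" | "x = 1 - k" | "x \<notin> {k - 2, k - 1, -k, 1 - k}"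
    by blast
  then show ?thesis
    by cases (use assms odd in \<open>simp_all add: refl_B_def\<close>)
qed

lemma refl_B_neg:
  assumes "k \<ge> 1"
  shows "refl_B k (-1 - x) = -1 - refl_B k x"
proof -
  have odd: "2 * k \<noteq> 3" by presburger
  consider "x = k - 2" | "x = k - 1" | "x = - k" | "x = 1 - k" | "x \<notin> {k - 2, k - 1, -k, 1 - k}"
    by blast
  then show ?thesis
    by cases (use assms odd in \<open>auto simp: refl_B_def\<close>)
qed

lemma refl_B_comm:
  assumes "j \<ge> 1" "k \<ge> j + 2"
  shows "refl_B j (refl_B k x) = refl_B k (refl_B j x)"
proof -
  consider "x = j - 1" | "x = 1 - j" | "x = j - 2" | "x = -j"
    | "x = k - 1" | "x = 1 - k" | "x = k - 2" | "x = -k"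
    | "x \<notin> {j - 1, 1 - j, j - 2, -j, k - 1, 1 - k, k - 2, -k}" by blast
  then show ?thesis
    by cases (use assms in \<open>simp_all add: refl_B_def\<close>)
qed

lemma refl_B_braid:
  assumes "k \<ge> 2"
  shows "refl_B k (refl_B (k+1) (refl_B k x)) = refl_B (k+1) (refl_B k (refl_B (k+1) x))"
proof -
  consider "x = k - 2" | "x = k - 1" | "x = k" | "x = -k-1" | "x = - k" | "x = 1 - k"
    | "x \<notin> {k - 2, k - 1, k, -k-1, -k, 1 - k}" by blast
  then show ?thesis
    by cases (use assms in \<open>simp_all add: refl_B_def\<close>)
qed

lemma refl_B_braid_1_2:
  "refl_B 1 (refl_B 2 (refl_B 1 (refl_B 2 x))) = refl_B 2 (refl_B 1 (refl_B 2 (refl_B 1 x)))"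
proof -
  consider "x = -2" | "x = -1" | "x = 0" | "x = 1" | "x \<notin> {-2,-1,0,1}" by blast
  then show ?thesis
    by cases (simp_all add: refl_B_def)
qed

text \<open>For involutions, the m-th power relation is a rearrangement of the braid relation of
  length m, so the pointwise identities above suffice.\<close>

lemma refl_B_relator:
  assumes "i \<ge> 1" "j \<ge> 1"
  shows "((refl_B (int i) \<circ> refl_B (int j)) ^^ cox_entry_B i j) x = x"
proof -
  have inv [simp]: "refl_B (int i) (refl_B (int i) y) = y"
    "refl_B (int j) (refl_B (int j) y) = y" for y
    using assms by (simp_all add: refl_B_invol)
  consider "i = j" | "i \<ge> j + 2" | "j \<ge> i + 2" | "i = 1" "j = 2" | "i = 2" "j = 1"
    | "j = i + 1" "i \<ge> 2" | "i = j + 1" "j \<ge> 2"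
    using assms by linarith
  then show ?thesis
  proof cases
    case 2
    then show ?thesis
      using assms refl_B_comm[of "int j" "int i"] by (simp add: cox_entry_B_def numeral_2_eq_2)
  next
    case 3
    then show ?thesis
      using assms refl_B_comm[of "int i" "int j"] by (simp add: cox_entry_B_def numeral_2_eq_2)
  next
    case 4
    then show ?thesis using inv
      by (simp add: cox_entry_B_def numeral_eq_Suc refl_B_braid_1_2)
  next
    case 5
    then show ?thesis using inv
      by (simp add: cox_entry_B_def numeral_eq_Suc flip: refl_B_braid_1_2)
  next
    case 6
    then show ?thesis using inv refl_B_braid[of "int i"]
      by (simp add: cox_entry_B_def numeral_3_eq_3 add.commute)
  next
    case 7
    then show ?thesis using inv refl_B_braid[of "int j"]
      by (simp add: cox_entry_B_def numeral_3_eq_3 add.commute)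
  qed (simp add: cox_entry_B_def)
qed

text \<open>A simple reflection makes only its own positive root negative. Here points move by at
  most one, so the order of two points is reversed only if they are neighbours exchanged with each
  other.\<close>

lemma refl_B_flips_one_root:
  assumes "k \<ge> 1" "p < q" "refl_B k p > refl_B k q"
  shows "(p = k - 2 \<and> q = k - 1) \<or> (p = - k \<and> q = 1 - k)"
  using assms unfolding refl_B_def by (simp split: if_splits) presburger


section \<open>Coxeter systems of type B\<close>

locale type_B_system =
  fixes n :: nat and s :: "nat \<Rightarrow> 'w::group_add"
  assumes n_ge: "n \<ge> 2" and type_B: "coxeter_system_type_B n s"
begin

abbreviation S :: "'w set" where "S \<equiv> s ` {1..n}"

lemma coxeter: "coxeter_system S"
  and inj_s: "inj_on s {1..n}"
  using type_B by (simp_all add: coxeter_system_type_B_def)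

lemma s_invol [simp]: "i \<in> {1..n} \<Longrightarrow> s i + s i = 0"
  using coxeter by (auto simp: coxeter_system_def)

lemma s_invol' [simp]: "i \<in> {1..n} \<Longrightarrow> s i + (s i + w) = w"
  by (simp flip: add.assoc)

lemma s_comm: "\<lbrakk>i \<in> {1..n}; j \<in> {1..n}; i + 1 < j\<rbrakk> \<Longrightarrow> s i + s j = s j + s i"
  using type_B unfolding coxeter_system_type_B_def by blast

lemma minus_s: "i \<in> {1..n} \<Longrightarrow> - s i = s i"
  by (simp add: neg_eq_iff_add_eq_0)

lemma s_eq_iff: "\<lbrakk>i \<in> {1..n}; j \<in> {1..n}\<rbrakk> \<Longrightarrow> s i = s j \<longleftrightarrow> i = j"
  using inj_on_eq_iff[OF inj_s] .

text \<open>The relators range over all ordered pairs, whereas the hypothesis gives orders only for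
  neighbours in increasing order. Commuting distinct involutions have a product of order exactly 2,
  and reversing a pair inverts the product.\<close>

lemma elt_order_s:
  assumes "i \<in> {1..n}" "j \<in> {1..n}"
  shows "elt_order (s i + s j) = cox_entry_B i j"
proof -
  have *: "elt_order (s i + s j) = cox_entry_B i j"
    if ij: "i \<in> {1..n}" "j \<in> {1..n}" "i \<le> j" for i j
  proof -
    consider "i = j" | "i = 1" "j = 2" | "i \<ge> 2" "j = i + 1" | "i + 1 < j"
      using ij unfolding atLeastAtMost_iff by linarith
    then show ?thesis
    proof cases
      case 1
      then show ?thesis using ij by (auto simp: cox_entry_B_def intro!: elt_order_eqI)
    next
      case 2
      then show ?thesis using type_B by (simp add: cox_entry_B_def coxeter_system_type_B_def)
    next
      case 3
      then show ?thesis using type_B ij by (simp add: cox_entry_B_def coxeter_system_type_B_def)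
    next
      case 4
      have "s i + s j \<noteq> 0"
        using 4 ij s_eq_iff[of i j] minus_s[of i] by (metis add_eq_0_iff nat_neq_iff trans_less_add1)
      moreover have "s i + s j + (s i + s j) = 0"
        using ij s_comm[OF ij(1,2) 4] by (metis add.assoc s_invol s_invol')
      ultimately have "elt_order (s i + s j) = 2"
        by (intro elt_order_eqI) (auto simp: numeral_2_eq_2 less_Suc_eq)
      with 4 show ?thesis by (simp add: cox_entry_B_def)
    qed
  qed
  show ?thesis
  proof (cases "i \<le> j")
    case False
    have "elt_order (s i + s j) = elt_order (- (s j + s i))"
      using assms by (simp only: minus_add minus_s)
    also have "\<dots> = cox_entry_B j i"
      using False assms * by (simp add: elt_order_uminus)
    finally show ?thesis by (auto simp: cox_entry_B_def)
  qed (use * assms in blast)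
qed

lemma braid:
  assumes "2 \<le> i" "Suc i \<le> n"
  shows "s i + (s (Suc i) + (s i + w)) = s (Suc i) + (s i + (s (Suc i) + w))"
proof -
  have "sum_list (replicate 3 (s i + s (Suc i))) = 0"
    using sum_list_replicate_elt_order[of "s i + s (Suc i)"] assms
    by (simp add: elt_order_s cox_entry_B_def)
  then have "s i + (s (Suc i) + (s i + (s (Suc i) + (s i + s (Suc i))))) = 0"
    by (simp add: numeral_3_eq_3 add.assoc)
  then have "s i + (s (Suc i) + s i) = - (s (Suc i) + (s i + s (Suc i)))"
    by (simp add: eq_neg_iff_add_eq_0 add.assoc)
  also have "\<dots> = s (Suc i) + (s i + s (Suc i))"
    using assms by (simp only: minus_add minus_s add.assoc) (simp add: minus_s)
  finally have "s i + (s (Suc i) + s i) + w = s (Suc i) + (s i + s (Suc i)) + w" by simp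
  then show ?thesis by (simp only: add.assoc)
qed

lemma braid_1_2: "s 1 + (s 2 + (s 1 + s 2)) = s 2 + (s 1 + (s 2 + s 1))"
proof -
  have "sum_list (replicate 4 (s 1 + s 2)) = 0"
    using sum_list_replicate_elt_order[of "s 1 + s 2"] n_ge
    by (simp add: elt_order_s cox_entry_B_def)
  then have "s 1 + (s 2 + (s 1 + s 2)) = - (s 1 + (s 2 + (s 1 + s 2)))"
    by (simp add: numeral_eq_Suc eq_neg_iff_add_eq_0 add.assoc)
  also have "\<dots> = s 2 + (s 1 + (s 2 + s 1))"
    using n_ge by (simp add: minus_add minus_s add.assoc del: add_uminus_conv_diff)
  finally show ?thesis .
qed

lemma W_induct [case_names zero step]:
  assumes "P 0" and "\<And>i w. i \<in> {1..n} \<Longrightarrow> P w \<Longrightarrow> P (s i + w)"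
  shows "P w"
proof -
  have "P (sum_list u)" if "u \<in> lists S" for u
    using that by (induction u) (use assms in auto)
  then show ?thesis using coxeter unfolding coxeter_system_def by metis
qed


subsection \<open>The representation by signed permutations\<close>

definition act :: "'w list \<Rightarrow> int \<Rightarrow> int" where
  "act u = foldr (\<lambda>a f. refl_B (int (inv_into {1..n} s a)) \<circ> f) u id"

lemma act_Nil [simp]: "act [] = id"
  by (simp add: act_def)

lemma act_Cons [simp]: "i \<in> {1..n} \<Longrightarrow> act (s i # u) = refl_B (int i) \<circ> act u"
  using inj_s by (simp add: act_def)

lemma act_append: "act (u @ v) = act u \<circ> act v"
proof -
  have "foldr (\<lambda>a f. F a \<circ> f) u g = foldr (\<lambda>a f. F a \<circ> f) u id \<circ> g" for F :: "'w \<Rightarrow> int \<Rightarrow> int" and g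
    by (induction u) (simp_all add: comp_assoc)
  then show ?thesis by (metis act_def foldr_append)
qed

lemma act_relator:
  assumes "i \<in> {1..n}" "j \<in> {1..n}"
  shows "act (concat (replicate (elt_order (s i + s j)) [s i, s j])) = id"
proof -
  have "act (concat (replicate k [s i, s j])) = (refl_B (int i) \<circ> refl_B (int j)) ^^ k" for k
    by (induction k) (use assms in \<open>simp_all add: comp_assoc id_def[symmetric]\<close>)
  then show ?thesis
    using assms refl_B_relator[of i j] by (auto simp: elt_order_s)
qed

lemma act_cong: "cox_equiv S u v \<Longrightarrow> act u = act v"
proof (induction rule: cox_equiv.induct)
  case (relator u v a b)
  then show ?case using act_relator by (auto simp: act_append)
qed simp_all

definition rho :: "'w \<Rightarrow> int \<Rightarrow> int" where
  "rho w = act (SOME u. u \<in> lists S \<and> sum_list u = w)"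

text \<open>This is where the presentation of W enters: two words for the same element are linked by
  relators, and relators act trivially, so the chosen word does not matter.\<close>

lemma rho_sum_list:
  assumes "u \<in> lists S"
  shows "rho (sum_list u) = act u"
proof -
  define v where "v = (SOME v. v \<in> lists S \<and> sum_list v = sum_list u)"
  have "v \<in> lists S \<and> sum_list v = sum_list u"
    unfolding v_def by (rule someI) (use assms in simp)
  then have "cox_equiv S v u"
    using assms coxeter unfolding coxeter_system_def by blast
  then show ?thesis
    using act_cong by (simp add: rho_def v_def)
qed

lemma rho_0 [simp]: "rho 0 x = x"
  using rho_sum_list[of "[]"] by simp

lemma rho_s_add [simp]: "i \<in> {1..n} \<Longrightarrow> rho (s i + w) x = refl_B (int i) (rho w x)"
proof -
  assume i: "i \<in> {1..n}"
  obtain u where "u \<in> lists S" "sum_list u = w"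
    using coxeter unfolding coxeter_system_def by metis
  with i show ?thesis
    using rho_sum_list[of u] rho_sum_list[of "s i # u"] by auto
qed

lemma rho_s [simp]: "i \<in> {1..n} \<Longrightarrow> rho (s i) x = refl_B (int i) x"
  using rho_s_add[of i 0 x] by simp

lemma rho_add: "rho (v + w) x = rho v (rho w x)"
  by (induction v rule: W_induct) (simp_all add: add.assoc)

lemma rho_neg: "rho w (-1 - x) = -1 - rho w x"
proof (induction w rule: W_induct)
  case (step i w)
  then show ?case using refl_B_neg[of "int i" "rho w x"] by simp
qed simp

lemma rho_eq_iff [simp]: "rho w x = rho w y \<longleftrightarrow> x = y"
proof -
  have "rho (- w) (rho w z) = z" for z
    by (simp flip: rho_add)
  then show ?thesis by metis
qed


subsection \<open>Coset representatives\<close>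

text \<open>For \<open>m \<le> n\<close> this is the subgroup <s_1, ..., s_m>: the generators are
  involutions, so left multiplication by them already produces inverses.\<close>

inductive_set parabolic :: "nat \<Rightarrow> 'w set" for m where
  zero [simp]: "0 \<in> parabolic m"
| step: "i \<in> {1..m} \<Longrightarrow> w \<in> parabolic m \<Longrightarrow> s i + w \<in> parabolic m"

lemma s_in_parabolic: "i \<in> {1..m} \<Longrightarrow> s i \<in> parabolic m"
  using parabolic.step[OF _ parabolic.zero, of i m] by simp

lemma parabolic_add: "v \<in> parabolic m \<Longrightarrow> w \<in> parabolic m \<Longrightarrow> v + w \<in> parabolic m"
  by (induction rule: parabolic.induct) (auto simp: add.assoc intro: parabolic.step)

lemma parabolic_mono: "v \<in> parabolic m \<Longrightarrow> m \<le> k \<Longrightarrow> v \<in> parabolic k"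
  by (induction rule: parabolic.induct) (auto intro: parabolic.step)

lemma parabolic_0: "parabolic 0 = {0}"
proof -
  have "w \<in> parabolic 0 \<Longrightarrow> w = 0" for w
    by (induction rule: parabolic.induct) auto
  then show ?thesis by auto
qed

lemma parabolic_n: "w \<in> parabolic n"
  by (induction w rule: W_induct) (auto intro: parabolic.step)

lemma parabolic_comm:
  "\<lbrakk>v \<in> parabolic m; m + 1 < j; j \<le> n\<rbrakk> \<Longrightarrow> s j + v = v + s j"
proof (induction rule: parabolic.induct)
  case (step i w)
  then have "s i + s j = s j + s i"
    using s_comm[of i j] by simp
  then have "s j + (s i + w) = s i + (s j + w)"
    by (metis add.assoc)
  with step show ?case by (simp add: add.assoc)
qed simp

lemma rho_parabolic_outside:
  "\<lbrakk>w \<in> parabolic m; m \<le> n; x \<notin> {- int m..int m - 1}\<rbrakk> \<Longrightarrow> rho w x = x"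
  by (induction rule: parabolic.induct) (auto simp: refl_B_def)

lemma rho_parabolic_inside:
  "\<lbrakk>w \<in> parabolic m; m \<le> n; x \<in> {- int m..int m - 1}\<rbrakk> \<Longrightarrow> rho w x \<in> {- int m..int m - 1}"
  by (induction rule: parabolic.induct) (auto simp: refl_B_def)

text \<open>The palindrome s_m ... s_2 s_1 s_2 ... s_m, a conjugate of s_1. The value at 0 is a
  default.\<close>

fun t :: "nat \<Rightarrow> 'w" where
  "t 0 = 0"
| "t (Suc 0) = s 1"
| "t (Suc (Suc m)) = s (Suc (Suc m)) + (t (Suc m) + s (Suc (Suc m)))"

lemma t_Suc: "m \<ge> 1 \<Longrightarrow> t (Suc m) = s (Suc m) + (t m + s (Suc m))"
  by (cases m) simp_all

lemma t_parabolic: "t m \<in> parabolic m"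
proof (induction m rule: t.induct)
  case (3 m)
  then show ?case
    by (auto intro!: parabolic_add s_in_parabolic parabolic_mono[OF 3])
qed (auto intro: s_in_parabolic)

lemma t_invol: "m \<le> n \<Longrightarrow> t m + t m = 0"
  by (induction m rule: t.induct) (simp_all add: add.assoc flip: add.assoc[of "t _" "t _"])

text \<open>A sign change of coordinate m commutes with all that happens on smaller coordinates. It
  is derived from the relations because faithfulness of the action depends on it. Generators far
  from s_m pass through s_m. The neighbour s_(m-1) is carried through t_m by two braid moves, or by
  the order 4 relation if m = 2.\<close>

lemma t_comm: "\<lbrakk>1 \<le> i; i < m; m \<le> n\<rbrakk> \<Longrightarrow> s i + t m = t m + s i"
proof (induction m arbitrary: i rule: less_induct)
  case (less m)
  then obtain k where k: "m = Suc k" "k \<ge> 1" by (cases m) auto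
  show ?case
  proof (cases "i = k")
    case False
    then have "s i + t k = t k + s i" "s i + s m = s m + s i"
      using less k s_comm[of i m] by auto
    then have "s i + (t k + w) = t k + (s i + w)" "s i + (s m + w) = s m + (s i + w)" for w
      by (simp_all flip: add.assoc)
    with k \<open>s i + s m = s m + s i\<close> show ?thesis
      by (simp add: t_Suc add.assoc)
  next
    case True
    show ?thesis
    proof (cases "k = 1")
      case True
      with \<open>i = k\<close> k show ?thesis
        using braid_1_2 by (simp add: t_Suc add.assoc numeral_2_eq_2)
    next
      case False
      then obtain l where l: "k = Suc l" "l \<ge> 1" using k by (cases k) auto
      have st: "s (Suc k) + (t l + w) = t l + (s (Suc k) + w)" for w
        using parabolic_comm[OF t_parabolic, of l "Suc k"] l k less.prems by (simp flip: add.assoc)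
      have tk: "t k = s k + (t l + s k)" using l t_Suc by simp
      have "s k + t (Suc k) = s k + (s (Suc k) + (s k + (t l + (s k + s (Suc k)))))"
        using k by (simp add: t_Suc tk add.assoc)
      also have "\<dots> = s (Suc k) + (s k + (s (Suc k) + (t l + (s k + s (Suc k)))))"
        using braid[of k] l k less.prems by simp
      also have "\<dots> = s (Suc k) + (s k + (t l + (s (Suc k) + (s k + s (Suc k)))))"
        using st by simp
      also have "s (Suc k) + (s k + s (Suc k)) = s k + (s (Suc k) + s k)"
        using braid[of k 0] l k less.prems by simp
      finally show ?thesis
        using k \<open>i = k\<close> by (simp add: t_Suc tk add.assoc)
    qed
  qed
qed

lemma t_comm_parabolic:
  assumes "v \<in> parabolic m" "m < k" "k \<le> n"
  shows "t k + v = v + t k"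
  using assms
proof (induction rule: parabolic.induct)
  case (step i w)
  then have "s i + t k = t k + s i"
    using t_comm[of i k] by simp
  then have "t k + (s i + w) = s i + (t k + w)"
    by (metis add.assoc)
  with step show ?case by (simp add: add.assoc)
qed simp

text \<open>\<open>D 0\<close> is empty, so that \<open>D 1 = {0, s 1}\<close> is covered by the recursion.\<close>

fun D :: "nat \<Rightarrow> 'w set" where
  "D 0 = {}"
| "D (Suc m) = insert 0 (insert (t (Suc m)) ((\<lambda>u. u + s (Suc m)) ` D m))"

lemma D_parabolic: "u \<in> D m \<Longrightarrow> u \<in> parabolic m"
proof (induction m arbitrary: u)
  case (Suc m)
  have "v + s (Suc m) \<in> parabolic (Suc m)" if "v \<in> D m" for v
    by (intro parabolic_add s_in_parabolic parabolic_mono[OF Suc.IH[OF that]]) auto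
  with Suc.prems t_parabolic[of "Suc m"] show ?case by (auto simp del: t.simps)
qed simp

lemma finite_D: "finite (D m)"
  by (induction m) auto

text \<open>The products of \<open>D m\<close> with the smaller parabolic subgroup are thus closed
  under left multiplication by generators, hence exhaust \<open>parabolic m\<close>. A generator
  either moves within \<open>D m\<close> or leaves it as a right factor.\<close>

lemma D_absorbs_generator:
  assumes "m \<le> n" "1 \<le> i" "i \<le> m" "u \<in> D m"
  shows "\<exists>u'\<in>D m. \<exists>v\<in>parabolic (m - 1). s i + u = u' + v"
  using assms
proof (induction m arbitrary: i u)
  case (Suc m)
  show ?case
  proof (cases "m = 0")
    case True
    with Suc.prems have "i = 1" by simp
    with True Suc.prems show ?thesis by (auto simp: parabolic_0)
  next
    case m: False
    have D0: "0 \<in> D m" and Dt: "t m \<in> D m" using m by (cases m; simp)+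
    from Suc.prems(4) consider "u = 0" | "u = t (Suc m)" | u' where "u' \<in> D m" "u = u' + s (Suc m)"
      by auto
    then show ?thesis
    proof cases
      case 1
      show ?thesis
      proof (cases "i = Suc m")
        case True
        then have "s i + u = (0 + s (Suc m)) + 0" using 1 by simp
        moreover have "0 + s (Suc m) \<in> D (Suc m)"
          using imageI[OF D0, of "\<lambda>u. u + s (Suc m)"] unfolding D.simps by blast
        ultimately show ?thesis using parabolic.zero by blast
      next
        case False
        then have "s i \<in> parabolic m" using Suc.prems by (intro s_in_parabolic) auto
        with 1 show ?thesis by auto
      qed
    next
      case 2
      show ?thesis
      proof (cases "i = Suc m")
        case True
        then have "s i + u = (t m + s (Suc m)) + 0"
          using 2 Suc.prems m by (simp add: t_Suc)
        then show ?thesis using parabolic.zero Dt by (metis D.simps(2) imageI insertI2)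
      next
        case False
        then have "s i + u = t (Suc m) + s i" "s i \<in> parabolic m"
          using Suc.prems 2 t_comm[of i "Suc m"] by (auto intro: s_in_parabolic)
        then show ?thesis by auto
      qed
    next
      case 3
      show ?thesis
      proof (cases "i = Suc m")
        case False
        then obtain u'' v where uv: "u'' \<in> D m" "v \<in> parabolic (m - 1)" "s i + u' = u'' + v"
          using Suc.IH[of i u'] Suc.prems 3 by auto
        have "s i + u = u'' + (v + s (Suc m))"
          using uv 3 by (simp flip: add.assoc)
        also have "\<dots> = (u'' + s (Suc m)) + v"
          using parabolic_comm[OF uv(2), of "Suc m"] Suc.prems m by (simp add: add.assoc)
        finally show ?thesis
          using uv parabolic_mono[OF uv(2), of m] by auto
      next
        case True
        obtain k where k: "m = Suc k" using m by (cases m) auto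
        from 3(1) k consider "u' = 0" | "u' = t m" | w where "w \<in> D k" "u' = w + s m"
          by auto
        then show ?thesis
        proof cases
          case 1
          with 3 True Suc.prems show ?thesis by (auto intro: bexI[of _ 0])
        next
          case 2
          with 3 True Suc.prems m have "s i + u = t (Suc m) + 0"
            by (simp add: t_Suc)
          then show ?thesis by (metis D.simps(2) insertI1 insertI2 parabolic.zero)
        next
          case (3 w)
          \<comment> \<open>Since \<open>D 0\<close> is empty, m is at least 2, and s_m, s_(m+1)
            satisfy the braid relation of length 3. As w commutes with s_(m+1), this relation pushes
            a factor s_m out to the right.\<close>
          then have "k \<noteq> 0" by (cases k) auto
          have "s i + u = s (Suc m) + (w + (s m + s (Suc m)))"
            using True 3 \<open>u = u' + s (Suc m)\<close> by (simp add: add.assoc)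
          also have "\<dots> = w + (s (Suc m) + (s m + s (Suc m)))"
            using parabolic_comm[OF D_parabolic[OF 3(1)], of "Suc m"] Suc.prems k
            by (simp flip: add.assoc)
          also have "\<dots> = ((w + s m) + s (Suc m)) + s m"
            using braid[of m 0] Suc.prems k \<open>k \<noteq> 0\<close> by (simp add: add.assoc)
          finally have "s i + u = ((w + s m) + s (Suc m)) + s m" .
          moreover have "(w + s m) + s (Suc m) \<in> D (Suc m)" using 3 k by auto
          moreover have "s m \<in> parabolic m" using k by (auto intro: s_in_parabolic)
          ultimately show ?thesis by auto
        qed
      qed
    qed
  qed
qed simp

lemma parabolic_Suc_factor:
  assumes "w \<in> parabolic (Suc m)" "Suc m \<le> n"
  obtains u v where "u \<in> D (Suc m)" "v \<in> parabolic m" "w = u + v"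
proof -
  have "\<exists>u\<in>D (Suc m). \<exists>v\<in>parabolic m. w = u + v"
    using assms(1)
  proof (induction rule: parabolic.induct)
    case zero
    have "0 \<in> D (Suc m)" by simp
    then show ?case using parabolic.zero by (metis add_0)
  next
    case (step i w)
    then obtain u v where uv: "u \<in> D (Suc m)" "v \<in> parabolic m" "w = u + v" by blast
    then obtain u' v' where "u' \<in> D (Suc m)" "v' \<in> parabolic m" "s i + u = u' + v'"
      using D_absorbs_generator[of "Suc m" i u] step assms(2) by (auto simp del: D.simps)
    moreover from this uv have "s i + w = u' + (v' + v)"
      by (simp flip: add.assoc)
    ultimately show ?case using uv parabolic_add by blast
  qed
  then show ?thesis using that by blast
qed

section \<open>Action of the coset representatives and faithfulness\<close>

lemma rho_t:
  "\<lbrakk>1 \<le> m; m \<le> n\<rbrakk> \<Longrightarrow> rho (t m) (int m - 1) = - int m"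
  "\<lbrakk>1 \<le> m; m \<le> n; x \<in> {1 - int m..int m - 2}\<rbrakk> \<Longrightarrow> rho (t m) x = x"
proof (induction m arbitrary: x rule: t.induct)
  case 2
  {
    case 1
    then show ?case by (simp add: refl_B_def)
  next
    case 2
    then show ?case by simp
  }
next
  case (3 m)
  have out: "rho (t (Suc m)) y = y" if "y \<notin> {- int (Suc m)..int m}" "Suc m \<le> n" for y
    using that rho_parabolic_outside[OF t_parabolic, of "Suc m" y] by simp
  {
    case 1
    then show ?case using 3(1) by (simp add: rho_add refl_B_def)
  next
    case 2
    then consider "x = int m" | "x = - int m - 1" | "x \<in> {1 - int (Suc m)..int (Suc m) - 2}"
      by fastforce
    then show ?case
    proof cases
      case 1
      then show ?thesis using 2 out[of "int m + 1"] by (simp add: rho_add refl_B_def)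
    next
      case 2
      then show ?thesis using \<open>Suc (Suc m) \<le> n\<close> out[of "- 2 - int m"] by (simp add: rho_add refl_B_def)
    next
      case 3
      then have "rho (t (Suc m)) x = x" using "3.IH"(2) 2 by simp
      with 3 2 show ?thesis by (simp add: rho_add refl_B_def)
    qed
  }
qed simp_all

text \<open>The identity keeps the top point, \<open>t\<close> sends it to the bottom, and the
  elements ending in a generator send it strictly inside, where the smaller coset set takes
  over.\<close>

lemma D_coset_inj:
  "\<lbrakk>m \<le> n; u \<in> D m; u' \<in> D m; rho u (int m - 1) = rho u' (int m - 1)\<rbrakk> \<Longrightarrow> u = u'"
proof (induction m arbitrary: u u')
  case (Suc m)
  have top: "rho (v + s (Suc m)) (int m) \<in> {- int m..int m - 1}
      \<and> rho (v + s (Suc m)) (int m) = rho v (int m - 1)" if "v \<in> D m" for v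
    using that Suc.prems rho_parabolic_inside[OF D_parabolic[OF that], of "int m - 1"]
    by (cases m) (auto simp: rho_add refl_B_def)
  have "rho (t (Suc m)) (int m) = - int (Suc m)"
    using rho_t(1)[of "Suc m"] Suc.prems by simp
  then show ?case
    using Suc.prems top Suc.IH by (fastforce simp del: t.simps)
qed simp

text \<open>The right factor fixes the top point, so the image of that point determines the left
  factor; cancelling it leaves the smaller subgroup.\<close>

lemma rho_inj_parabolic: "\<lbrakk>m \<le> n; w \<in> parabolic m; w' \<in> parabolic m; rho w = rho w'\<rbrakk> \<Longrightarrow> w = w'"
proof (induction m arbitrary: w w')
  case 0
  then show ?case by (simp add: parabolic_0)
next
  case (Suc m)
  obtain u v where uv: "u \<in> D (Suc m)" "v \<in> parabolic m" "w = u + v"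
    using parabolic_Suc_factor Suc.prems by metis
  obtain u' v' where uv': "u' \<in> D (Suc m)" "v' \<in> parabolic m" "w' = u' + v'"
    using parabolic_Suc_factor Suc.prems by metis
  have top: "rho v (int m) = int m" "rho v' (int m) = int m"
    using rho_parabolic_outside uv uv' Suc.prems by simp_all
  have *: "rho u (rho v x) = rho u' (rho v' x)" for x
    using fun_cong[OF Suc.prems(4), of x] uv uv' by (simp add: rho_add)
  have "u = u'"
    using D_coset_inj[of "Suc m" u u'] uv uv' Suc.prems *[of "int m"] top by simp
  with * have "rho v = rho v'" by auto
  with Suc uv uv' \<open>u = u'\<close> show ?case by simp
qed

lemma rho_inj: "rho w = rho w' \<Longrightarrow> w = w'"
  using rho_inj_parabolic parabolic_n by blast

text \<open>This is minimality of the coset representatives in terms of the action: they preserve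
  the order of the inner points. Right multiplication by the new generator sends the two outermost
  inner points to the two ends and leaves the others to the previous representative.\<close>

lemma rho_D_mono:
  "\<lbrakk>m \<le> n; u \<in> D m; 1 - int m \<le> x; x < y; y \<le> int m - 2\<rbrakk> \<Longrightarrow> rho u x < rho u y"
proof (induction m arbitrary: u x y)
  case (Suc m)
  from Suc.prems(2) consider "u = 0" | "u = t (Suc m)" | v where "v \<in> D m" "u = v + s (Suc m)"
    by auto
  then show ?case
  proof cases
    case 2
    then show ?thesis using Suc.prems rho_t(2)[of "Suc m"] by simp
  next
    case 3
    have out: "rho v z = z" if "z \<notin> {- int m..int m - 1}" for z
      using rho_parabolic_outside[OF D_parabolic[OF 3(1)]] Suc.prems that by simp
    have ins: "rho v z \<in> {- int m..int m - 1}" if "z \<in> {- int m..int m - 1}" for z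
      using rho_parabolic_inside[OF D_parabolic[OF 3(1)]] Suc.prems that by simp
    have u: "rho u z = (if z = int m - 1 then int m else if z = - int m then - int m - 1 else rho v z)"
      if "- int m \<le> z" "z \<le> int m - 1" for z
      using that 3 Suc.prems out[of "int m"] out[of "- int m - 1"]
      by (auto simp: rho_add refl_B_def)
    show ?thesis
      using u[of x] u[of y] ins[of x] ins[of y] Suc.prems Suc.IH[of v x y] 3 by auto
  qed (use Suc.prems in simp)
qed simp


subsection \<open>Ascents\<close>

text \<open>Positivity of the image under w of the simple root of s_i. For i = 1 the points compared
  are -1 and 0, which are negatives of each other, so the condition says that the first coordinate
  keeps a positive sign.\<close>

definition ascent :: "'w \<Rightarrow> nat \<Rightarrow> bool" where
  "ascent w i \<longleftrightarrow> rho w (int i - 2) < rho w (int i - 1)"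

text \<open>If s_k turns the ascent of w at i into a descent, then w carries the pair of s_i to a
  pair exchanged by s_k, and by symmetry also the mirror pair. Hence s_k is the conjugate of s_i by
  w.\<close>

lemma refl_B_commute_rho:
  assumes i: "i \<in> {1..n}" and k: "k \<ge> 1"
    and asc: "ascent w i" and "refl_B k (rho w (int i - 2)) > refl_B k (rho w (int i - 1))"
  shows "refl_B k (rho w x) = rho w (refl_B (int i) x)"
proof -
  have neg: "rho w (- int i) = -1 - rho w (int i - 1)" "rho w (1 - int i) = -1 - rho w (int i - 2)"
    using rho_neg[of w "int i - 1"] rho_neg[of w "int i - 2"] by simp_all
  have odd: "2 * int i \<noteq> 3" "2 * k \<noteq> 3" by presburger+
  from refl_B_flips_one_root[OF k _ assms(4)] asc
  consider "rho w (int i - 2) = k - 2" "rho w (int i - 1) = k - 1"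
    | "rho w (int i - 2) = - k" "rho w (int i - 1) = 1 - k"
    unfolding ascent_def by blast
  then have vals: "{rho w (int i - 2), rho w (int i - 1), rho w (- int i), rho w (1 - int i)}
      = {k - 2, k - 1, - k, 1 - k}"
    and v: "refl_B k (rho w (int i - 2)) = rho w (int i - 1)"
    by (cases; insert k odd; force simp: neg refl_B_def)+
  have v': "refl_B k (rho w (int i - 1)) = rho w (int i - 2)"
    using v refl_B_invol[OF k, of "rho w (int i - 2)"] by simp
  consider "x = int i - 2" | "x = int i - 1" | "x = - int i" | "x = 1 - int i"
    | "x \<notin> {int i - 2, int i - 1, - int i, 1 - int i}" by blast
  then show ?thesis
  proof cases
    case 1
    then have "refl_B (int i) x = int i - 1" using i odd by (simp add: refl_B_def)
    with 1 v show ?thesis by simp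
  next
    case 2
    then have "refl_B (int i) x = int i - 2" using i by (simp add: refl_B_def)
    with 2 v' show ?thesis by simp
  next
    case 3
    then have "refl_B (int i) x = 1 - int i" using i by (simp add: refl_B_def)
    with 3 v' show ?thesis
      using refl_B_neg[OF k, of "rho w (int i - 1)"] by (simp add: neg)
  next
    case 4
    then have "refl_B (int i) x = - int i" using i by (simp add: refl_B_def)
    with 4 v show ?thesis
      using refl_B_neg[OF k, of "rho w (int i - 2)"] by (simp add: neg)
  next
    case 5
    then have "rho w x \<notin> {k - 2, k - 1, - k, 1 - k}"
      unfolding vals[symmetric] by simp
    with 5 show ?thesis by (simp add: refl_B_def)
  qed
qed

text \<open>The exchange property: the first letter, from the right, that turns the
  \<open>i\<close>-th ascent into a descent can be deleted after multiplication by \<open>s i\<close>.\<close>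

lemma descent_shorten:
  assumes "u \<in> lists S" "i \<in> {1..n}" "\<not> ascent (sum_list u) i"
  shows "\<exists>v\<in>lists S. length v < length u \<and> sum_list v = sum_list u + s i"
  using assms
proof (induction u rule: list.induct)
  case Nil
  then show ?case by (simp add: ascent_def)
next
  case (Cons a u)
  have "a \<in> S" using Cons.prems(1) by simp
  then obtain k where k: "k \<in> {1..n}" "a = s k" by blast
  show ?case
  proof (cases "ascent (sum_list u) i")
    case False
    then obtain v where v: "v \<in> lists S" "length v < length u" "sum_list v = sum_list u + s i"
      using Cons by auto
    then show ?thesis
      using Cons.prems by (intro bexI[of _ "a # v"]) (auto simp: add.assoc)
  next
    case True
    have gt: "rho (s k + sum_list u) (int i - 2) > rho (s k + sum_list u) (int i - 1)"
    proof -
      have "rho (s k + sum_list u) (int i - 2) \<noteq> rho (s k + sum_list u) (int i - 1)"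
        unfolding rho_eq_iff by simp
      moreover have "\<not> rho (s k + sum_list u) (int i - 2) < rho (s k + sum_list u) (int i - 1)"
        using Cons.prems(3) unfolding ascent_def k sum_list.Cons .
      ultimately show ?thesis by linarith
    qed
    have "refl_B (int k) (rho (sum_list u) x) = rho (sum_list u) (refl_B (int i) x)" for x
      by (rule refl_B_commute_rho[OF Cons.prems(2) _ True])
        (use k gt in \<open>simp_all only: rho_s_add[OF k(1)], simp\<close>)
    then have "rho (s k + sum_list u) = rho (sum_list u + s i)"
      unfolding rho_add fun_eq_iff rho_s[OF k(1)] rho_s[OF Cons.prems(2)] by blast
    then have "s k + sum_list u = sum_list u + s i" by (rule rho_inj)
    then have "sum_list (a # u) + s i = sum_list u"
      using k Cons.prems by (simp add: add.assoc)
    then show ?thesis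
      using Cons.prems by (intro bexI[of _ u]) auto
  qed
qed

lemma descent_length:
  assumes "i \<in> {1..n}" "\<not> ascent w i"
  shows "cox_length S (w + s i) < cox_length S w"
proof -
  have "\<exists>k. \<exists>u\<in>lists S. length u = k \<and> sum_list u = w"
    using coxeter unfolding coxeter_system_def by metis
  from LeastI_ex[OF this] obtain u where u: "u \<in> lists S" "length u = cox_length S w" "sum_list u = w"
    unfolding cox_length_def by blast
  with assms descent_shorten[of u i] obtain v
    where v: "v \<in> lists S" "length v < length u" "sum_list v = w + s i" by auto
  have "cox_length S (w + s i) \<le> length v"
    unfolding cox_length_def by (rule Least_le) (use v in auto)
  with u v show ?thesis by simp
qed

lemma ascent_add_s: "i \<in> {1..n} \<Longrightarrow> ascent (w + s i) i \<longleftrightarrow> \<not> ascent w i"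
proof -
  assume i: "i \<in> {1..n}"
  then have "refl_B (int i) (int i - 2) = int i - 1" "refl_B (int i) (int i - 1) = int i - 2"
    by (simp_all add: refl_B_def) presburger
  then show ?thesis
    using i rho_eq_iff[of w "int i - 2" "int i - 1"]
    by (simp add: ascent_def rho_add order_le_less not_less del: rho_eq_iff)
qed

text \<open>The ascent case is the descent case for \<open>w + s i\<close>, since multiplication by
  s_i toggles the ascent.\<close>

lemma ascent_iff_length:
  assumes "i \<in> {1..n}"
  shows "cox_length S (w + s i) > cox_length S w \<longleftrightarrow> ascent w i"
  using assms descent_length[of i w] descent_length[of i "w + s i"] ascent_add_s[of i w]
  by (auto simp: add.assoc)

text \<open>The analogue of X_J inside a parabolic subgroup, with m free so that one coset factor
  can be split off at a time.\<close>

definition ascending :: "nat \<Rightarrow> nat \<Rightarrow> 'w set" where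
  "ascending m j = {w \<in> parabolic m. \<forall>i\<in>{1..j}. ascent w i}"

lemma cox_X_eq: "j \<le> n \<Longrightarrow> cox_X S (s ` {1..j}) = ascending n j"
  using ascent_iff_length by (auto simp: cox_X_def ascending_def parabolic_n)

lemma ascent_coset:
  assumes "u \<in> D m" "v \<in> parabolic (m - 1)" "m \<le> n" "1 \<le> i" "i < m"
  shows "ascent (u + v) i \<longleftrightarrow> ascent v i"
proof -
  have "rho v x \<in> {1 - int m..int m - 2}" if "x \<in> {int i - 2, int i - 1}" for x
    using rho_parabolic_inside[OF assms(2), of x] that assms by auto
  then have "rho v (int i - 2) \<in> {1 - int m..int m - 2}" "rho v (int i - 1) \<in> {1 - int m..int m - 2}"
    by simp_all
  then show ?thesis
    using rho_D_mono[OF assms(3,1), of "rho v (int i - 2)" "rho v (int i - 1)"]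
      rho_D_mono[OF assms(3,1), of "rho v (int i - 1)" "rho v (int i - 2)"]
      rho_eq_iff[of v "int i - 2" "int i - 1"]
    unfolding ascent_def rho_add atLeastAtMost_iff by linarith
qed

lemma ascending_top: "m \<le> n \<Longrightarrow> ascending m m = {0}"
proof (induction m)
  case 0
  then show ?case by (auto simp: ascending_def parabolic_0)
next
  case (Suc m)
  have "w = 0" if w: "w \<in> ascending (Suc m) (Suc m)" for w
  proof -
    obtain u v where uv: "u \<in> D (Suc m)" "v \<in> parabolic m" "w = u + v"
      using parabolic_Suc_factor w Suc.prems unfolding ascending_def by blast
    then have "v \<in> ascending m m"
      using w Suc.prems ascent_coset[of u "Suc m" v] by (auto simp: ascending_def)
    then have "w = u" using Suc uv by simp
    with w have "ascent u (Suc m)" by (auto simp: ascending_def)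
    then have asc: "rho u (int m - 1) < rho u (int m)"
      by (simp add: ascent_def)
    from uv(1) consider "u = 0" | "u = t (Suc m)" | z where "z \<in> D m" "u = z + s (Suc m)"
      by auto
    then show ?thesis
    proof cases
      case 2
      have "rho u (int m - 1) \<in> {- int (Suc m)..int m}"
        using rho_parabolic_inside[OF D_parabolic[OF uv(1)], of "int m - 1"] Suc.prems by simp
      with 2 asc rho_t(1)[of "Suc m"] Suc.prems show ?thesis by simp
    next
      case 3
      then have "m \<noteq> 0" by (cases m) auto
      with 3 asc show ?thesis
        using rho_parabolic_outside[OF D_parabolic[OF 3(1)], of "int m"]
          rho_parabolic_inside[OF D_parabolic[OF 3(1)], of "int m - 1"] Suc.prems
        by (simp add: rho_add refl_B_def)
    qed (use \<open>w = u\<close> in simp)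
  qed
  moreover have "0 \<in> ascending (Suc m) (Suc m)" by (simp add: ascending_def ascent_def)
  ultimately show ?case by blast
qed

text \<open>Ascents at positions up to m depend only on the right factor, so the factorization of
  \<open>parabolic (Suc m)\<close> restricts. The image of the top point makes it unique.\<close>

lemma ascending_Suc:
  assumes "j \<le> m" "Suc m \<le> n"
  shows "bij_betw (\<lambda>(u, v). u + v) (D (Suc m) \<times> ascending m j) (ascending (Suc m) j)"
proof -
  have asc: "ascent (u + v) i \<longleftrightarrow> ascent v i"
    if "u \<in> D (Suc m)" "v \<in> parabolic m" "i \<in> {1..j}" for u v i
    using ascent_coset[of u "Suc m" v i] that assms by simp
  have "inj_on (\<lambda>(u, v). u + v) (D (Suc m) \<times> ascending m j)"
  proof (rule inj_onI, clarify)
    fix u v u' v'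
    assume *: "u \<in> D (Suc m)" "v \<in> ascending m j" "u' \<in> D (Suc m)" "v' \<in> ascending m j" "u + v = u' + v'"
    have "rho v (int m) = int m" "rho v' (int m) = int m"
      using * assms rho_parabolic_outside[of _ m "int m"] by (auto simp: ascending_def)
    then have "rho u (int m) = rho u' (int m)"
      using arg_cong[OF *(5), of "\<lambda>w. rho w (int m)"] by (simp add: rho_add)
    then show "u = u' \<and> v = v'"
      using * assms D_coset_inj[of "Suc m" u u'] by simp
  qed
  moreover have "(\<lambda>(u, v). u + v) ` (D (Suc m) \<times> ascending m j) = ascending (Suc m) j"
  proof (intro equalityI subsetI)
    fix w assume "w \<in> (\<lambda>(u, v). u + v) ` (D (Suc m) \<times> ascending m j)"
    then show "w \<in> ascending (Suc m) j"
      using asc by (auto simp: ascending_def simp del: D.simps intro!: parabolic_add intro: D_parabolic parabolic_mono)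
  next
    fix w assume w: "w \<in> ascending (Suc m) j"
    then obtain u v where "u \<in> D (Suc m)" "v \<in> parabolic m" "w = u + v"
      using parabolic_Suc_factor assms unfolding ascending_def by blast
    with w asc show "w \<in> (\<lambda>(u, v). u + v) ` (D (Suc m) \<times> ascending m j)"
      by (auto simp: ascending_def)
  qed
  ultimately show ?thesis by (simp add: bij_betw_def)
qed

end


subsection \<open>The coset sums\<close>

lemma sum_single_mult_sum_single:
  fixes A B :: "'w::monoid_add set"
  shows "(\<Sum>u\<in>A. Poly_Mapping.single u (1::rat)) * (\<Sum>v\<in>B. Poly_Mapping.single v 1) =
         (\<Sum>(u, v)\<in>A \<times> B. Poly_Mapping.single (u + v) 1)"
  by (simp add: sum_product sum.cartesian_product mult_single)

text \<open>Here \<open>d\<close> and \<open>e\<close> are the two coset sums before \<open>D\<close>. The braid relation is only needed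
  after multiplication by \<open>e\<close>, which includes the case \<open>e = 0\<close> of the pair \<open>s 1, s 2\<close> of order 4.\<close>

lemma coset_sum_step:
  fixes d e s t r :: "'a::ring_1"
  assumes dd: "d * d = d * e + 2 * d" and der: "d * e * r = d * e" and d: "d = 1 + e * r + t"
    and dt: "d * t = d" and ss: "s * s = 1" and tt: "t * t = 1" and se: "s * e = e * s"
    and comm: "s * t * s * d = d * (s * t * s)" and braid: "e * (s * r * s) = e * (r * s * r)"
  defines "D \<equiv> 1 + d * s + s * t * s"
  shows "D * D = D * d + 2 * D"
proof -
  have ss': "s * (s * x) = x" and tt': "t * (t * x) = x" for x
    by (simp_all add: ss tt flip: mult.assoc)
  have sts: "s * t * s * (s * t * s) = 1"
    by (simp add: mult.assoc ss' tt' ss)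
  have stsds: "s * t * s * d * s = d * s * t"
    unfolding comm by (simp add: mult.assoc ss)
  \<comment> \<open>Only the second \<open>d\<close> is expanded: s then passes e, the braid
    relation exposes d e r, and \<open>der\<close> absorbs that r.\<close>
  have "d * s * d * s = d * (s * (1 + e * r + t) * s)"
    by (subst (2) d) (simp add: mult.assoc)
  also have "\<dots> = d * (1 + s * e * r * s + s * t * s)"
    by (simp add: distrib_left distrib_right ss mult.assoc)
  also have "s * e * r * s = e * (s * r * s)"
    unfolding se by (simp add: mult.assoc)
  also have "d * (1 + e * (s * r * s) + s * t * s) = d + d * e * r * s * r + d * (s * t * s)"
    unfolding braid by (simp add: distrib_left mult.assoc)
  finally have dsds: "d * s * d * s = d + d * e * s * r + d * (s * t * s)"
    unfolding der .
  have "d * s * d = d * (s * (1 + e * r + t))"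
    by (subst (2) d) (simp add: mult.assoc)
  also have "\<dots> = d * s + d * (s * e) * r + d * s * t"
    by (simp add: distrib_left mult.assoc)
  finally have dsd: "d * s * d = d * s + d * e * s * r + d * s * t"
    unfolding se by (simp add: mult.assoc)
  have dssts: "d * s * (s * t * s) = d * s"
    using dt by (simp add: mult.assoc ss') (metis mult.assoc)
  have "D * D = D + (d * s + d * s * d * s + d * s * (s * t * s))
      + (s * t * s + s * t * s * d * s + s * t * s * (s * t * s))"
    unfolding D_def by (simp add: distrib_left distrib_right mult.assoc)
  also have "\<dots> = D + (d * s + (d + d * e * s * r + d * (s * t * s)) + d * s)
      + (s * t * s + d * s * t + 1)"
    unfolding dsds dssts stsds sts ..
  also have "\<dots> = D * d + 2 * D"
    unfolding D_def distrib_right[of _ _ d] dsd comm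
    by (simp add: distrib_left distrib_right mult_2)
  finally show ?thesis .
qed

context type_B_system
begin

definition gsum :: "'w set \<Rightarrow> 'w \<Rightarrow>\<^sub>0 rat" where
  "gsum A = (\<Sum>w\<in>A. Poly_Mapping.single w 1)"

abbreviation \<delta> :: "'w \<Rightarrow> 'w \<Rightarrow>\<^sub>0 rat" where
  "\<delta> w \<equiv> Poly_Mapping.single w 1"

lemma delta_add: "\<delta> (v + w) = \<delta> v * \<delta> w"
  by (simp add: mult_single)

definition d :: "nat \<Rightarrow> 'w \<Rightarrow>\<^sub>0 rat" where
  "d m = gsum (D m)"

lemma d_0 [simp]: "d 0 = 0"
  by (simp add: d_def gsum_def)

text \<open>The union defining \<open>D\<close> becomes a sum because its three parts are disjoint:
  they send the top point to the top, to the bottom and inside.\<close>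

lemma d_Suc:
  assumes "Suc m \<le> n"
  shows "d (Suc m) = 1 + d m * \<delta> (s (Suc m)) + \<delta> (t (Suc m))"
proof -
  let ?A = "(\<lambda>u. u + s (Suc m)) ` D m"
  have A: "rho w (int m) \<in> {- int m..int m - 1}" if w: "w \<in> ?A" for w
  proof -
    obtain u where u: "u \<in> D m" "w = u + s (Suc m)" using w by blast
    then have "m \<noteq> 0" by (cases m) auto
    then have "rho w (int m) = rho u (int m - 1)"
      using u assms by (simp add: rho_add refl_B_def)
    then show ?thesis
      using rho_parabolic_inside[OF D_parabolic[OF u(1)], of "int m - 1"] \<open>m \<noteq> 0\<close> assms by simp
  qed
  have t: "rho (t (Suc m)) (int m) = - int m - 1"
    using rho_t(1)[of "Suc m"] assms by simp
  have "t (Suc m) \<notin> ?A" using A[of "t (Suc m)"] t by auto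
  moreover have "0 \<notin> ?A" using A[of 0] by auto
  moreover have "t (Suc m) \<noteq> 0" using t rho_0[of "int m"] by (auto simp del: rho_0 t.simps)
  moreover have "finite ?A" using finite_D by blast
  moreover have "gsum ?A = d m * \<delta> (s (Suc m))"
    unfolding gsum_def d_def
    by (subst sum.reindex) (auto simp: inj_on_def sum_distrib_right mult_single)
  ultimately show ?thesis
    by (simp add: d_def gsum_def add_ac del: t.simps)
qed

lemma delta_comm: "v + w = w + v \<Longrightarrow> \<delta> v * \<delta> w = \<delta> w * \<delta> v"
  by (metis delta_add)

lemma delta_comm_d:
  assumes "\<And>v. v \<in> parabolic m \<Longrightarrow> w + v = v + w"
  shows "\<delta> w * d m = d m * \<delta> w"
  unfolding d_def gsum_def sum_distrib_left sum_distrib_right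
  using assms D_parabolic by (intro sum.cong refl delta_comm) auto

text \<open>Right multiplication by t_m permutes D m: it exchanges 1 and t_m, and on D (m-1) s_m it
  acts through t_(m-1), because s_m t_m = t_(m-1) s_m.\<close>

lemma d_mult_t: "m \<le> n \<Longrightarrow> d m * \<delta> (t m) = d m"
proof (induction m)
  case (Suc m)
  have tt: "\<delta> (t (Suc m)) * \<delta> (t (Suc m)) = 1"
    using t_invol[of "Suc m"] Suc.prems by (simp add: mult_single del: t.simps)
  have "d m * \<delta> (s (Suc m)) * \<delta> (t (Suc m)) = d m * \<delta> (s (Suc m))"
  proof (cases "m = 0")
    case False
    then have "\<delta> (s (Suc m)) * \<delta> (t (Suc m)) = \<delta> (t m) * \<delta> (s (Suc m))"
      using Suc.prems by (simp add: t_Suc mult_single)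
    then show ?thesis
      using Suc by (simp add: mult.assoc) (metis Suc_leD mult.assoc)
  qed simp
  then show ?case
    unfolding d_Suc[OF Suc.prems] distrib_right tt by (simp add: add_ac)
qed simp

lemma d_square: "m \<le> n \<Longrightarrow> d m * d m = d m * d (m - 1) + 2 * d m"
proof (induction m rule: less_induct)
  case (less m)
  consider "m = 0" | "m = 1" | k where "m = Suc (Suc k)"
    by (metis One_nat_def not0_implies_Suc)
  then show ?case
  proof cases
    case 2
    have "\<delta> (s 1) * \<delta> (s 1) = 1"
      using n_ge by (simp add: mult_single)
    with 2 show ?thesis
      using less.prems d_Suc[of 0] by (simp add: distrib_left distrib_right mult_2)
  next
    case (3 k)
    define l where "l = Suc k"
    have l: "m = Suc l" "l - 1 = k" "l \<ge> 1" "l < m" "l \<le> n" "Suc l \<le> n" "Suc k \<le> n"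
      using 3 less.prems by (simp_all add: l_def)
    have dd: "d l * d l = d l * d k + 2 * d l"
      using less.IH[of l] l by simp
    have dl: "d l = 1 + d k * \<delta> (s l) + \<delta> (t l)"
      using d_Suc[of k] l by (simp only: l_def)
    have dt: "d l * \<delta> (t l) = d l" using d_mult_t l by simp
    \<comment> \<open>Comparing this expansion of the square with the induction hypothesis
      \<open>dd\<close> yields the absorption of s_l.\<close>
    have "d l * d l = d l + d l * d k * \<delta> (s l) + d l"
      by (subst (2) dl) (simp add: distrib_left dt mult.assoc)
    then have der: "d l * d k * \<delta> (s l) = d l * d k"
      unfolding dd by (simp add: mult_2 mult_2_right add_ac)
    have ss: "\<delta> (s m) * \<delta> (s m) = 1"
      using l less.prems by (simp add: mult_single)
    have tt: "\<delta> (t l) * \<delta> (t l) = 1"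
      using t_invol[of l] l by (simp add: mult_single)
    have se: "\<delta> (s m) * d k = d k * \<delta> (s m)"
      using 3 less.prems by (intro delta_comm_d parabolic_comm) auto
    have tm: "\<delta> (s m) * \<delta> (t l) * \<delta> (s m) = \<delta> (t m)"
      using l by (simp add: t_Suc mult_single add.assoc)
    have comm: "\<delta> (s m) * \<delta> (t l) * \<delta> (s m) * d l = d l * (\<delta> (s m) * \<delta> (t l) * \<delta> (s m))"
      unfolding tm using l less.prems by (intro delta_comm_d t_comm_parabolic) auto
    have braid: "d k * (\<delta> (s m) * \<delta> (s l) * \<delta> (s m)) = d k * (\<delta> (s l) * \<delta> (s m) * \<delta> (s l))"
    proof (cases "k = 0")
      case False
      then show ?thesis
        using braid[of l 0] l by (simp add: mult_single add.assoc l_def)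
    qed simp
    have dm: "d m = 1 + d l * \<delta> (s m) + \<delta> (s m) * \<delta> (t l) * \<delta> (s m)"
      unfolding tm using d_Suc[of l] l by simp
    show ?thesis
      using coset_sum_step[OF dd der dl dt ss tt se comm braid] l dm by simp
  qed simp
qed

lemma gsum_ascending_top: "m \<le> n \<Longrightarrow> gsum (ascending m m) = 1"
  by (simp add: ascending_top gsum_def)

lemma gsum_ascending_Suc:
  assumes "j \<le> m" "Suc m \<le> n"
  shows "gsum (ascending (Suc m) j) = d (Suc m) * gsum (ascending m j)"
proof -
  have "gsum (ascending (Suc m) j) = (\<Sum>(u, v)\<in>D (Suc m) \<times> ascending m j. \<delta> (u + v))"
    unfolding gsum_def
    by (subst sum.reindex_bij_betw[OF ascending_Suc[OF assms], symmetric]) (simp only: case_prod_unfold)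
  then show ?thesis
    by (simp only: d_def gsum_def sum_single_mult_sum_single)
qed

text \<open>The sum over \<open>ascending m (m - k)\<close> is the product d_m ... d_(m-k+1).
  Multiplying by d_m, the quadratic relation contributes 2 and hands d_(m-1) to the next factor; k
  factors contribute 2k. The remaining d_(m-k) extends the product, or vanishes when k = m.\<close>

lemma d_mult_gsum_ascending:
  "\<lbrakk>k \<le> m; m \<le> n\<rbrakk> \<Longrightarrow> d m * gsum (ascending m (m - k)) =
     (if k < m then gsum (ascending m (m - Suc k)) else 0) + of_nat (2 * k) * gsum (ascending m (m - k))"
proof (induction k arbitrary: m)
  case 0
  show ?case
  proof (cases m)
    case (Suc l)
    then show ?thesis using 0 gsum_ascending_Suc[of l l] by (simp add: gsum_ascending_top)
  qed simp
next
  case (Suc k)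
  then obtain l where l: "m = Suc l" by (cases m) auto
  let ?g = "gsum (ascending l (l - k))"
  have g: "gsum (ascending m (m - Suc k)) = d m * ?g"
    using l Suc.prems gsum_ascending_Suc[of "l - k" l] by simp
  have "d m * (d m * ?g) = d m * d m * ?g" by (simp only: mult.assoc)
  also have "\<dots> = d m * (d l * ?g) + 2 * (d m * ?g)"
    unfolding d_square[OF Suc.prems(2)] using l by (simp add: distrib_right mult.assoc)
  also have "d l * ?g = (if k < l then gsum (ascending l (l - Suc k)) else 0) + of_nat (2 * k) * ?g"
    using Suc l by simp
  finally have *: "d m * (d m * ?g) = d m * ((if k < l then gsum (ascending l (l - Suc k)) else 0)
      + of_nat (2 * k) * ?g) + 2 * (d m * ?g)" .
  have "d m * (of_nat (2 * k) * ?g) = of_nat (2 * k) * (d m * ?g)"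
    by (metis mult.assoc mult_of_nat_commute)
  then have "d m * (d m * ?g) = (if k < l then d m * gsum (ascending l (l - Suc k)) else 0) + of_nat (2 * k) * (d m * ?g)
      + 2 * (d m * ?g)"
    unfolding * distrib_left by (simp only: if_distrib[of "(*) (d m)"] mult_zero_right)
  also have "(if k < l then d m * gsum (ascending l (l - Suc k)) else 0) =
      (if Suc k < m then gsum (ascending m (m - Suc (Suc k))) else 0)"
    using l Suc.prems gsum_ascending_Suc[of "l - Suc k" l] by simp
  finally show ?case
    unfolding g by (simp add: distrib_right add.assoc mult_2)
qed

end


section \<open>Algebras generated by a root of a falling power\<close>

lemma poly_mapping_single_sum_induct [case_names single sum]:
  fixes a :: "'a \<Rightarrow>\<^sub>0 'b::comm_monoid_add"
  assumes "\<And>k v. P (Poly_Mapping.single k v)" and "\<And>f g. P f \<Longrightarrow> P g \<Longrightarrow> P (f + g)"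
  shows "P a"
proof -
  have "P (\<Sum>k\<in>A. Poly_Mapping.single k (Poly_Mapping.lookup a k))" for A
    by (induction A rule: infinite_finite_induct) (use assms(1)[of undefined 0] assms in auto)
  moreover have "(\<Sum>k\<in>Poly_Mapping.keys a. Poly_Mapping.single k (Poly_Mapping.lookup a k)) = a"
    by (rule poly_mapping_eqI)
      (auto simp: lookup_sum lookup_single when_def in_keys_iff sum.delta')
  ultimately show ?thesis by metis
qed

text \<open>Scalars become elements of the algebra, shown to be central below, so that moving them
  through products is ring arithmetic.\<close>

lemma qscale_eq_single_mult: "qscale c a = Poly_Mapping.single 0 c * (a :: 'w::monoid_add \<Rightarrow>\<^sub>0 rat)"
proof -
  have "Poly_Mapping.map ((*) c) a = Poly_Mapping.single 0 c * a"
  proof (induction a rule: poly_mapping_single_sum_induct)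
    case (single k v)
    show ?case
      by (rule poly_mapping_eqI)
        (simp add: mult_single lookup_single Poly_Mapping.map.rep_eq when_def)
  next
    case (sum f g)
    have "qscale c (f + g) = qscale c f + qscale c g"
      by (rule group_algebra.scale_right_distrib)
    with sum show ?case by (simp add: distrib_left qscale_def)
  qed
  then show ?thesis by (simp add: qscale_def)
qed

lemma qscale_mult_left: "qscale c a * b = qscale c (a * (b :: 'w::monoid_add \<Rightarrow>\<^sub>0 rat))"
  by (simp add: qscale_eq_single_mult mult.assoc)

lemma single_0_mult_commute:
  "Poly_Mapping.single 0 c * a = a * Poly_Mapping.single 0 (c :: rat)" for a :: "'w::monoid_add \<Rightarrow>\<^sub>0 rat"
proof (induction a rule: poly_mapping_single_sum_induct)
  case (single k v)
  show ?case by (simp add: mult_single mult.commute)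
next
  case (sum f g)
  then show ?case by (simp add: distrib_left distrib_right)
qed

lemma qscale_mult_right: "a * qscale c b = qscale c (a * (b :: 'w::monoid_add \<Rightarrow>\<^sub>0 rat))"
  by (metis mult.assoc qscale_eq_single_mult single_0_mult_commute)

lemma qscale_of_nat: "qscale (of_nat k) a = of_nat k * (a :: 'w::monoid_add \<Rightarrow>\<^sub>0 rat)"
  by (simp add: qscale_eq_single_mult)

lemma family_independentI:
  fixes n :: nat and b :: "nat \<Rightarrow> 'w \<Rightarrow>\<^sub>0 rat"
  assumes "\<And>c. (\<Sum>k\<le>n. qscale (c k) (b k)) = 0 \<Longrightarrow> \<forall>k\<le>n. c k = 0"
  shows "inj_on b {..n} \<and> group_algebra.independent (b ` {..n})"
proof
  show inj: "inj_on b {..n}"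
  proof (rule inj_onI, rule ccontr)
    fix i j assume ij: "i \<in> {..n}" "j \<in> {..n}" "b i = b j" "i \<noteq> j"
    define c where "c k = (if k = i then 1 else if k = j then -1 else (0::rat))" for k
    have "(\<Sum>k\<le>n. qscale (c k) (b k)) = (\<Sum>k\<in>{i, j}. qscale (c k) (b k))"
      using ij by (intro sum.mono_neutral_right) (auto simp: c_def)
    also have "\<dots> = 0" using ij by (simp add: c_def)
    finally have "c i = 0" using assms ij by blast
    then show False by (simp add: c_def)
  qed
  show "group_algebra.independent (b ` {..n})"
  proof (rule group_algebra.independent_if_scalars_zero)
    fix f v assume "(\<Sum>v\<in>b ` {..n}. qscale (f v) v) = 0" "v \<in> b ` {..n}"
    then show "f v = 0"
      using assms[of "f \<circ> b"] by (auto simp: sum.reindex[OF inj])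
  qed simp
qed

text \<open>Horner evaluation with rational coefficients in a noncommutative algebra. It is still
  multiplicative, since only scalars have to be moved past z.\<close>

definition poly_eval :: "('w::monoid_add \<Rightarrow>\<^sub>0 rat) \<Rightarrow> rat poly \<Rightarrow> 'w \<Rightarrow>\<^sub>0 rat" where
  "poly_eval z p = fold_coeffs (\<lambda>a f. qscale a 1 + z * f) p 0"

lemma poly_eval_0 [simp]: "poly_eval z 0 = 0"
  by (simp add: poly_eval_def)

lemma poly_eval_pCons [simp]: "poly_eval z (pCons a p) = qscale a 1 + z * poly_eval z p"
  by (cases "a = 0 \<and> p = 0") (auto simp: poly_eval_def)

lemma poly_eval_1 [simp]: "poly_eval z 1 = 1"
  by (simp add: one_pCons)

lemma poly_eval_add: "poly_eval z (p + q) = poly_eval z p + poly_eval z q"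
  by (induction p q rule: poly_induct2)
    (simp_all add: distrib_left group_algebra.scale_left_distrib add_ac)

lemma poly_eval_smult: "poly_eval z (smult c p) = qscale c (poly_eval z p)"
  by (induction p) (simp_all add: group_algebra.scale_right_distrib qscale_mult_right)

lemma poly_eval_mult: "poly_eval z (p * q) = poly_eval z p * poly_eval z q"
  by (induction p) (simp_all add: poly_eval_add poly_eval_smult distrib_right qscale_mult_left mult.assoc)

lemma poly_eval_sum: "poly_eval z (\<Sum>i\<in>A. p i) = (\<Sum>i\<in>A. poly_eval z (p i))"
  by (induction A rule: infinite_finite_induct) (simp_all add: poly_eval_add)

lemma poly_eval_monom: "poly_eval z (monom c k) = qscale c (z ^ k)"
  by (induction k) (simp_all add: monom_0 monom_Suc qscale_mult_right)

section \<open>Falling powers as a basis of the polynomials\<close>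

lemma falling_power_Suc: "falling_power x (Suc k) = falling_power x k * (x - of_nat k)"
  by (simp add: falling_power_def)

lemma degree_falling_power:
  "degree (falling_power [:0, 1:] k :: 'a::idom poly) = k \<and> lead_coeff (falling_power [:0, 1:] k :: 'a poly) = 1"
proof (induction k)
  case (Suc k)
  have "[:0, 1:] - of_nat k = [:- of_nat k, 1 :: 'a:]"
    by (simp add: of_nat_poly)
  moreover have "falling_power [:0, 1:] k \<noteq> (0 :: 'a poly)"
    using Suc by auto
  moreover have "lead_coeff (falling_power [:0, 1:] k * [:- of_nat k, 1 :: 'a:]) = 1"
    by (simp only: lead_coeff_mult conjunct2[OF Suc]) simp
  ultimately show ?case
    using Suc unfolding falling_power_Suc by (simp add: degree_mult_eq del: mult_pCons_right)
qed (simp add: falling_power_def)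

lemma falling_power_expansion:
  assumes "degree p \<le> n"
  obtains c where "p = (\<Sum>k\<le>n. smult (c k) (falling_power [:0, 1:] k :: 'a::idom poly))"
proof -
  have "\<exists>c. p = (\<Sum>k\<le>n. smult (c k) (falling_power [:0, 1:] k))"
    using assms
  proof (induction n arbitrary: p)
    case 0
    then obtain a where "p = [:a:]" by (metis degree_eq_zeroE le_zero_eq)
    then show ?case by (auto simp: falling_power_def)
  next
    case (Suc n)
    let ?f = "falling_power [:0, 1:] (Suc n) :: 'a poly"
    have f: "degree ?f = Suc n" "coeff ?f (Suc n) = 1"
      using degree_falling_power[of "Suc n"] by metis+
    have "degree (p - smult (coeff p (Suc n)) ?f) \<le> n"
    proof (rule degree_le, intro allI impI)
      fix i assume "n < i"
      then consider "i = Suc n" | "i > Suc n" by linarith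
      then show "coeff (p - smult (coeff p (Suc n)) ?f) i = 0"
        by cases (use f Suc.prems in \<open>auto simp: coeff_eq_0\<close>)
    qed
    then obtain c where c: "p - smult (coeff p (Suc n)) ?f = (\<Sum>k\<le>n. smult (c k) (falling_power [:0, 1:] k))"
      using Suc.IH by blast
    have "p = (\<Sum>k\<le>Suc n. smult ((c(Suc n := coeff p (Suc n))) k) (falling_power [:0, 1:] k))"
      using c by (simp add: algebra_simps)
    then show ?case by blast
  qed
  then show ?thesis using that by blast
qed

text \<open>All that is kept of the Coxeter group, with \<open>b k\<close> for x_(n-k) and
  \<open>y\<close> for x_(n-1): a two-term recursion that closes at n, and independence.\<close>

locale falling_chain =
  fixes n :: nat and b :: "nat \<Rightarrow> 'w::group_add \<Rightarrow>\<^sub>0 rat" and y :: "'w \<Rightarrow>\<^sub>0 rat"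
  assumes b_0: "b 0 = 1"
    and y_mult_b: "k < n \<Longrightarrow> y * b k = b (Suc k) + qscale (2 * of_nat k) (b k)"
    and y_mult_b_n: "y * b n = qscale (2 * of_nat n) (b n)"
    and b_indep: "(\<Sum>k\<le>n. qscale (c k) (b k)) = 0 \<Longrightarrow> \<forall>k\<le>n. c k = 0"
begin

lemma b_eq_sum_powers:
  "k \<le> n \<Longrightarrow> b k = (\<Sum>m\<le>k. qscale ((-2) ^ (k - m) * of_nat (stirling k m)) (y ^ m))"
proof (induction k)
  case 0
  then show ?case by (simp add: b_0)
next
  case (Suc k)
  let ?c = "\<lambda>k m. (-2) ^ (k - m) * rat_of_nat (stirling k m)"
  \<comment> \<open>The Stirling recursion scaled by powers of -2. For m = k the exponent k - Suc m
    is truncated, but its Stirling number is 0.\<close>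
  have rec: "?c (Suc k) (Suc m) = ?c k m - 2 * of_nat k * ?c k (Suc m)" if "m \<le> k" for m
  proof (cases "m = k")
    case False
    with that have "k - m = Suc (k - Suc m)" by simp
    then show ?thesis by (simp add: algebra_simps)
  qed simp
  have k0: "of_nat k * ?c k 0 = 0" by (cases k) simp_all
  have "b (Suc k) = y * b k - qscale (2 * of_nat k) (b k)"
    using y_mult_b[of k] Suc.prems by simp
  also have "b k = (\<Sum>m\<le>k. qscale (?c k m) (y ^ m))" using Suc by simp
  also have "y * \<dots> = (\<Sum>m\<le>k. qscale (?c k m) (y ^ Suc m))"
    by (simp add: sum_distrib_left qscale_mult_right)
  also have "qscale (2 * of_nat k) (\<Sum>m\<le>k. qscale (?c k m) (y ^ m)) =
      (\<Sum>m\<le>Suc k. qscale (2 * of_nat k * ?c k m) (y ^ m))"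
    by (simp add: group_algebra.scale_sum_right)
  also have "\<dots> = (\<Sum>m\<le>k. qscale (2 * of_nat k * ?c k (Suc m)) (y ^ Suc m))"
    using k0 by (subst sum.atMost_Suc_shift) (simp add: mult.assoc)
  also have "(\<Sum>m\<le>k. qscale (?c k m) (y ^ Suc m)) - \<dots> = (\<Sum>m\<le>k. qscale (?c (Suc k) (Suc m)) (y ^ Suc m))"
    unfolding sum_subtractf[symmetric] group_algebra.scale_left_diff_distrib[symmetric]
  proof (rule sum.cong)
    fix m assume "m \<in> {..k}"
    then have "m \<le> k" by simp
    show "qscale (?c k m - 2 * of_nat k * ?c k (Suc m)) (y ^ Suc m) = qscale (?c (Suc k) (Suc m)) (y ^ Suc m)"
      unfolding rec[OF \<open>m \<le> k\<close>] ..
  qed simp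
  also have "\<dots> = (\<Sum>m\<le>Suc k. qscale (?c (Suc k) m) (y ^ m))"
    by (subst sum.atMost_Suc_shift) simp
  finally show ?case .
qed

lemma power_eq_sum_b:
  "k \<le> n \<Longrightarrow> y ^ k = (\<Sum>m\<le>k. qscale (of_nat (Stirling k m) * 2 ^ (k - m)) (b m))"
proof (induction k)
  case 0
  then show ?case by (simp add: b_0)
next
  case (Suc k)
  let ?c = "\<lambda>k m. rat_of_nat (Stirling k m) * 2 ^ (k - m)"
  have rec: "?c (Suc k) (Suc m) = ?c k m + 2 * of_nat (Suc m) * ?c k (Suc m)" if "m \<le> k" for m
  proof (cases "m = k")
    case False
    with that have "k - m = Suc (k - Suc m)" by simp
    then show ?thesis by (simp add: algebra_simps)
  qed simp
  have "y ^ Suc k = (\<Sum>m\<le>k. qscale (?c k m) (y * b m))"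
    using Suc by (simp add: sum_distrib_left qscale_mult_right)
  also have "\<dots> = (\<Sum>m\<le>k. qscale (?c k m) (b (Suc m)) + qscale (2 * of_nat m * ?c k m) (b m))"
  proof (rule sum.cong)
    fix m assume "m \<in> {..k}"
    then have "y * b m = b (Suc m) + qscale (2 * of_nat m) (b m)"
      using Suc.prems y_mult_b by simp
    then show "qscale (?c k m) (y * b m) = qscale (?c k m) (b (Suc m)) + qscale (2 * of_nat m * ?c k m) (b m)"
      by (simp only: group_algebra.scale_right_distrib group_algebra.scale_scale mult.commute)
  qed simp
  also have "\<dots> = (\<Sum>m\<le>k. qscale (?c k m) (b (Suc m))) + (\<Sum>m\<le>Suc k. qscale (2 * of_nat m * ?c k m) (b m))"
    by (simp add: sum.distrib)
  \<comment> \<open>The term m = 0 vanishes through its factor m; the term m = k + 1 was added with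
    Stirling number 0 so that the shifted ranges agree.\<close>
  also have "(\<Sum>m\<le>Suc k. qscale (2 * of_nat m * ?c k m) (b m)) =
      (\<Sum>m\<le>k. qscale (2 * of_nat (Suc m) * ?c k (Suc m)) (b (Suc m)))"
    by (subst sum.atMost_Suc_shift) simp
  also have "(\<Sum>m\<le>k. qscale (?c k m) (b (Suc m))) + \<dots> = (\<Sum>m\<le>k. qscale (?c (Suc k) (Suc m)) (b (Suc m)))"
    unfolding sum.distrib[symmetric] group_algebra.scale_left_distrib[symmetric]
  proof (rule sum.cong)
    fix m assume "m \<in> {..k}"
    then have "m \<le> k" by simp
    show "qscale (?c k m + 2 * of_nat (Suc m) * ?c k (Suc m)) (b (Suc m)) = qscale (?c (Suc k) (Suc m)) (b (Suc m))"
      unfolding rec[OF \<open>m \<le> k\<close>] ..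
  qed simp
  also have "\<dots> = (\<Sum>m\<le>Suc k. qscale (?c (Suc k) m) (b m))"
    by (subst sum.atMost_Suc_shift) simp
  finally show ?case .
qed

text \<open>Halving turns the roots 0, 2, ..., 2n of the recursion for \<open>y\<close> into 0, 1,
  ..., n, those of the falling power.\<close>

definition z :: "'w \<Rightarrow>\<^sub>0 rat" where "z = qscale (1/2) y"

abbreviation T :: "rat poly" where "T \<equiv> [:0, 1:]"

lemma y_mult: "y * a = qscale 2 (z * a)"
  by (simp add: z_def qscale_mult_left)

lemma poly_eval_falling_power_Suc:
  "poly_eval z (falling_power T (Suc k)) = z * poly_eval z (falling_power T k) - qscale (of_nat k) (poly_eval z (falling_power T k))"
proof -
  have "falling_power T (Suc k) + smult (of_nat k) (falling_power T k) = T * falling_power T k"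
    by (simp add: falling_power_Suc algebra_simps of_nat_poly)
  then have "poly_eval z (falling_power T (Suc k)) + qscale (of_nat k) (poly_eval z (falling_power T k))
      = poly_eval z T * poly_eval z (falling_power T k)"
    by (metis poly_eval_add poly_eval_mult poly_eval_smult)
  then show ?thesis by (simp add: eq_diff_eq)
qed

lemma qscale_poly_eval_falling_power_Suc:
  "qscale (2 ^ Suc k) (poly_eval z (falling_power T (Suc k))) =
     y * qscale (2 ^ k) (poly_eval z (falling_power T k))
       - qscale (2 * of_nat k) (qscale (2 ^ k) (poly_eval z (falling_power T k)))"
proof -
  let ?F = "poly_eval z (falling_power T k)"
  have "y * qscale (2 ^ k) ?F = qscale (2 ^ Suc k) (z * ?F)"
    by (simp add: y_mult qscale_mult_right)
  moreover have "qscale (2 * of_nat k) (qscale (2 ^ k) ?F) = qscale (2 ^ Suc k) (qscale (of_nat k) ?F)"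
    by (simp add: mult_ac)
  ultimately show ?thesis
    by (simp only: poly_eval_falling_power_Suc group_algebra.scale_right_diff_distrib)
qed

lemma b_eq_poly_eval: "k \<le> n \<Longrightarrow> b k = qscale (2 ^ k) (poly_eval z (falling_power T k))"
proof (induction k)
  case 0
  then show ?case by (simp add: b_0 falling_power_def)
next
  case (Suc k)
  have "b (Suc k) = y * b k - qscale (2 * of_nat k) (b k)"
    using y_mult_b[of k] Suc.prems by simp
  then show ?case
    using Suc by (simp only: qscale_poly_eval_falling_power_Suc)
qed

lemma poly_eval_falling_power_n: "poly_eval z (falling_power T (Suc n)) = 0"
proof -
  have "qscale (2 ^ Suc n) (poly_eval z (falling_power T (Suc n))) = y * b n - qscale (2 * of_nat n) (b n)"
    by (simp only: qscale_poly_eval_falling_power_Suc b_eq_poly_eval)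
  then show ?thesis by (simp add: y_mult_b_n)
qed

text \<open>In the basis of falling powers, evaluation at z gives a combination of the
  \<open>b k\<close> with coefficients divided by powers of 2, which independence forces to be
  0.\<close>

lemma poly_eval_eq_0_degree_le:
  assumes "poly_eval z p = 0" "degree p \<le> n"
  shows "p = 0"
proof -
  obtain c where c: "p = (\<Sum>k\<le>n. smult (c k) (falling_power T k))"
    using falling_power_expansion[OF assms(2)] by blast
  have "(\<Sum>k\<le>n. qscale (c k / 2 ^ k) (b k)) = poly_eval z p"
    by (simp add: c poly_eval_sum poly_eval_smult b_eq_poly_eval)
  then have "\<forall>k\<le>n. c k / 2 ^ k = 0"
    using assms(1) b_indep[of "\<lambda>k. c k / 2 ^ k"] by simp
  then show ?thesis by (simp add: c)
qed

lemma poly_eval_eq_0_iff: "poly_eval z p = 0 \<longleftrightarrow> falling_power T (Suc n) dvd p"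
proof
  let ?f = "falling_power T (Suc n)"
  assume p: "poly_eval z p = 0"
  have f: "degree ?f = Suc n" "?f \<noteq> 0" using degree_falling_power[of "Suc n", where 'a = rat] by auto
  have "poly_eval z p = poly_eval z (p div ?f * ?f + p mod ?f)"
    by (simp only: div_mult_mod_eq)
  then have "poly_eval z (p mod ?f) = 0"
    unfolding poly_eval_add poly_eval_mult poly_eval_falling_power_n using p by simp
  moreover have "degree (p mod ?f) \<le> n"
    using degree_mod_less[OF f(2), of p] f(1) by auto
  ultimately show "?f dvd p"
    using poly_eval_eq_0_degree_le by auto
next
  assume "falling_power T (Suc n) dvd p"
  then show "poly_eval z p = 0"
    by (auto simp: poly_eval_mult poly_eval_falling_power_n elim!: dvdE)
qed

lemma gen_subalgebra_eq_range: "gen_subalgebra y = range (poly_eval z)"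
  unfolding gen_subalgebra_def
proof (rule hull_unique)
  have "y = poly_eval z [:0, 2:]"
    by (simp add: z_def qscale_mult_right)
  then show "{y} \<subseteq> range (poly_eval z)" by blast
  have "group_algebra.subspace (range (poly_eval z))"
    by (rule group_algebra.subspaceI)
      (auto simp flip: poly_eval_add poly_eval_smult poly_eval_0[of z] simp del: poly_eval_0)
  moreover have "1 \<in> range (poly_eval z)" by (metis poly_eval_1 rangeI)
  moreover have "a * c \<in> range (poly_eval z)"
    if "a \<in> range (poly_eval z)" "c \<in> range (poly_eval z)" for a c
    using that by (auto simp flip: poly_eval_mult)
  ultimately show "unital_subalgebra (range (poly_eval z))"
    by (simp add: unital_subalgebra_def)
next
  fix A assume A: "{y} \<subseteq> A" "unital_subalgebra A"
  then have "z \<in> A"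
    by (simp add: z_def unital_subalgebra_def group_algebra.subspace_scale)
  have "poly_eval z p \<in> A" for p
    by (induction p) (use A \<open>z \<in> A\<close> in \<open>auto simp: unital_subalgebra_def
        intro!: group_algebra.subspace_add group_algebra.subspace_scale group_algebra.subspace_0\<close>)
  then show "range (poly_eval z) \<subseteq> A" by blast
qed

text \<open>The span contains 1 = \<open>b 0\<close> and, by the recursion and its closing relation,
  is stable under \<open>y\<close>, hence under z; so it contains every polynomial in z.\<close>

lemma span_b_eq: "group_algebra.span (b ` {..n}) = gen_subalgebra y"
proof -
  let ?V = "group_algebra.span (b ` {..n})"
  have sub: "group_algebra.subspace ?V" by (rule group_algebra.subspace_span)
  have b: "b k \<in> ?V" if "k \<le> n" for k
    using that by (intro group_algebra.span_base) auto
  have yb: "y * b k \<in> ?V" if "k \<le> n" for k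
  proof (cases "k = n")
    case True
    then show ?thesis using b[of n] by (simp add: y_mult_b_n group_algebra.span_scale)
  next
    case False
    with that b[of k] b[of "Suc k"] show ?thesis
      by (simp add: y_mult_b group_algebra.span_add group_algebra.span_scale)
  qed
  have "z * v \<in> ?V" if "v \<in> ?V" for v
    using that
  proof (induction rule: group_algebra.span_induct_alt)
    case (step c x v)
    then have "z * x \<in> ?V"
      using yb by (auto simp: z_def qscale_mult_left intro: group_algebra.span_scale)
    with step show ?case
      by (simp add: distrib_left qscale_mult_right group_algebra.span_add group_algebra.span_scale)
  qed (simp add: group_algebra.span_zero)
  then have "poly_eval z p \<in> ?V" for p
    by (induction p) (use b[of 0] b_0 in \<open>auto intro!: group_algebra.span_add
        group_algebra.span_scale simp: group_algebra.span_zero\<close>)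
  moreover have "?V \<subseteq> range (poly_eval z)"
  proof (rule group_algebra.span_minimal)
    show "b ` {..n} \<subseteq> range (poly_eval z)"
      by (auto simp: b_eq_poly_eval simp flip: poly_eval_smult)
    show "group_algebra.subspace (range (poly_eval z))"
      by (rule group_algebra.subspaceI)
        (auto simp flip: poly_eval_add poly_eval_smult poly_eval_0[of z] simp del: poly_eval_0)
  qed
  ultimately show ?thesis
    unfolding gen_subalgebra_eq_range by blast
qed

lemma family_basis_powers: "family_basis (\<lambda>m. y ^ m) n (gen_subalgebra y)"
proof -
  have y_power: "y ^ m = poly_eval z (monom (2 ^ m) m)" for m
    by (induction m) (simp_all add: poly_eval_monom y_mult qscale_mult_right)
  have "\<forall>k\<le>n. c k = 0" if "(\<Sum>k\<le>n. qscale (c k) (y ^ k)) = 0" for c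
  proof -
    define p where "p = (\<Sum>k\<le>n. monom (c k * 2 ^ k) k)"
    have "poly_eval z p = (\<Sum>k\<le>n. qscale (c k) (y ^ k))"
      by (simp add: p_def poly_eval_sum y_power poly_eval_monom)
    moreover have "degree p \<le> n"
      unfolding p_def by (rule degree_sum_le) (auto intro: order_trans[OF degree_monom_le])
    ultimately have "p = 0" using that poly_eval_eq_0_degree_le by simp
    moreover have "coeff p k = c k * 2 ^ k" if "k \<le> n" for k
      using that by (simp add: p_def coeff_sum)
    ultimately show ?thesis by auto
  qed
  from family_independentI[OF this]
  have "inj_on (\<lambda>m. y ^ m) {..n}" "group_algebra.independent ((\<lambda>m. y ^ m) ` {..n})" by auto
  moreover have "group_algebra.span ((\<lambda>m. y ^ m) ` {..n}) = gen_subalgebra y"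
  proof
    have "y ^ m \<in> gen_subalgebra y" for m
      unfolding gen_subalgebra_eq_range y_power by blast
    then show "group_algebra.span ((\<lambda>m. y ^ m) ` {..n}) \<subseteq> gen_subalgebra y"
      unfolding span_b_eq[symmetric]
      by (intro group_algebra.span_minimal group_algebra.subspace_span) auto
    have "b k \<in> group_algebra.span ((\<lambda>m. y ^ m) ` {..n})" if "k \<le> n" for k
      unfolding b_eq_sum_powers[OF that] using that
      by (intro group_algebra.span_sum group_algebra.span_scale group_algebra.span_base) auto
    then show "gen_subalgebra y \<subseteq> group_algebra.span ((\<lambda>m. y ^ m) ` {..n})"
      unfolding span_b_eq[symmetric]
      by (intro group_algebra.span_minimal group_algebra.subspace_span) auto
  qed
  ultimately show ?thesis by (simp add: family_basis_def)
qed

end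


section \<open>The algebra generated by the last coset sum\<close>

context type_B_system
begin

text \<open>A sum over an infinite set would be 0 by default. Finiteness comes from the
  factorization into finite coset sets.\<close>

lemma finite_ascending: "\<lbrakk>j \<le> m; m \<le> n\<rbrakk> \<Longrightarrow> finite (ascending m j)"
proof (induction rule: dec_induct)
  case base
  then show ?case by (simp add: ascending_top)
next
  case (step m)
  then have "finite (D (Suc m) \<times> ascending m j)" using finite_D by simp
  with step show ?case using bij_betw_finite[OF ascending_Suc[of j m]] by simp
qed

lemma ascent_s:
  assumes "i \<in> {1..n}" "j \<in> {1..n}"
  shows "ascent (s j) i \<longleftrightarrow> i \<noteq> j"
proof (cases "i = j")
  case True
  then show ?thesis using assms ascent_add_s[of i 0] by (simp add: ascent_def)
next
  case False
  have "refl_B (int j) (int i - 2) \<noteq> refl_B (int j) (int i - 1)"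
    using rho_eq_iff[of "s j" "int i - 2" "int i - 1"]
    unfolding rho_s[OF assms(2)] by simp
  moreover have "\<not> refl_B (int j) (int i - 2) > refl_B (int j) (int i - 1)"
    using refl_B_flips_one_root[of "int j" "int i - 2" "int i - 1"] assms False by auto
  ultimately show ?thesis
    using assms False by (simp add: ascent_def)
qed

lemma lookup_gsum: "finite A \<Longrightarrow> Poly_Mapping.lookup (gsum A) w = (if w \<in> A then 1 else 0)"
  by (simp add: gsum_def lookup_sum lookup_single when_def sum.delta)

text \<open>The generator s_(k+1) has its only descent at k + 1, so it lies in X_j exactly for j at
  most k, and its coefficient in the relation is a partial sum of the \<open>c j\<close>. The
  identity gives the full sum. Differences of partial sums are the \<open>c j\<close>.\<close>

lemma gsum_ascending_independent:
  assumes "(\<Sum>j\<le>n. qscale (c j) (gsum (ascending n j))) = 0"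
  shows "\<forall>j\<le>n. c j = 0"
proof -
  have eq: "(\<Sum>j\<le>n. c j * (if w \<in> ascending n j then 1 else 0)) = 0" for w
  proof -
    have "(\<Sum>j\<le>n. c j * (if w \<in> ascending n j then 1 else 0)) =
        Poly_Mapping.lookup (\<Sum>j\<le>n. qscale (c j) (gsum (ascending n j))) w"
      unfolding lookup_sum lookup_qscale
    proof (rule sum.cong)
      fix j assume "j \<in> {..n}"
      then have "finite (ascending n j)" by (intro finite_ascending) auto
      then show "c j * (if w \<in> ascending n j then 1 else 0) = c j * Poly_Mapping.lookup (gsum (ascending n j)) w"
        by (simp only: lookup_gsum)
    qed simp
    then show ?thesis by (simp add: assms)
  qed
  have partial: "(\<Sum>j\<le>k. c j) = 0" if "k \<le> n" for k
  proof (cases "k = n")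
    case True
    have "0 \<in> ascending n j" for j by (simp add: ascending_def ascent_def)
    with eq[of 0] True show ?thesis by simp
  next
    case False
    with that have "s (Suc k) \<in> ascending n j \<longleftrightarrow> j \<le> k" if "j \<le> n" for j
      using that ascent_s[of _ "Suc k"] by (auto simp: ascending_def parabolic_n)
    then have "(\<Sum>j\<le>n. c j * (if s (Suc k) \<in> ascending n j then 1 else 0)) = (\<Sum>j\<le>n. if j \<le> k then c j else 0)"
      by (intro sum.cong) auto
    also have "\<dots> = (\<Sum>j\<le>k. c j)"
      using that by (subst sum.inter_filter[symmetric]) (auto intro!: sum.cong)
    finally show ?thesis using eq by simp
  qed
  show ?thesis
  proof (intro allI impI)
    fix j assume "j \<le> n"
    then show "c j = 0"
      using partial[of j] partial[of "j - 1"] by (cases j) simp_all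
  qed
qed

lemma type_B_x_eq: "j \<le> n \<Longrightarrow> type_B_x n s j = gsum (ascending n j)"
  unfolding type_B_x_def cox_x_def gsum_def by (simp only: cox_X_eq)

lemma falling_chain_type_B: "falling_chain n (\<lambda>k. type_B_x n s (n - k)) (type_B_x n s (n - 1))"
proof -
  have x1: "type_B_x n s (n - 1) = d n"
    using gsum_ascending_Suc[of "n - 1" "n - 1"] gsum_ascending_top[of "n - 1"] n_ge by (simp add: type_B_x_eq)
  have rec: "d n * gsum (ascending n (n - k)) =
      (if k < n then gsum (ascending n (n - Suc k)) else 0) + qscale (2 * of_nat k) (gsum (ascending n (n - k)))"
    if "k \<le> n" for k
    using d_mult_gsum_ascending[OF that] qscale_of_nat[of "2 * k" "gsum (ascending n (n - k))"] by simp
  show ?thesis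
  proof
    show "type_B_x n s (n - 0) = 1" by (simp add: type_B_x_eq gsum_ascending_top)
    show "type_B_x n s (n - 1) * type_B_x n s (n - k) =
        type_B_x n s (n - Suc k) + qscale (2 * of_nat k) (type_B_x n s (n - k))" if "k < n" for k
      using rec[of k] that unfolding x1 by (simp add: type_B_x_eq)
    show "type_B_x n s (n - 1) * type_B_x n s (n - n) = qscale (2 * of_nat n) (type_B_x n s (n - n))"
      using rec[of n] unfolding x1 by (simp add: type_B_x_eq)
    show "\<forall>k\<le>n. c k = 0" if "(\<Sum>k\<le>n. qscale (c k) (type_B_x n s (n - k))) = 0" for c
    proof -
      have "(\<Sum>j\<le>n. qscale (c (n - j)) (gsum (ascending n j))) = (\<Sum>k\<le>n. qscale (c k) (type_B_x n s (n - k)))"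
        by (rule sum.reindex_bij_witness[of _ "\<lambda>k. n - k" "\<lambda>k. n - k"]) (auto simp: type_B_x_eq)
      with that gsum_ascending_independent[of "\<lambda>j. c (n - j)"]
      have *: "\<forall>j\<le>n. c (n - j) = 0" by simp
      show ?thesis
      proof (intro allI impI)
        fix k assume "k \<le> n"
        then show "c k = 0" using *[rule_format, of "n - k"] by simp
      qed
    qed
  qed
qed

lemma family_basis_type_B_x: "family_basis (type_B_x n s) n (gen_subalgebra (type_B_x n s (n - 1)))"
proof -
  interpret falling_chain n "\<lambda>k. type_B_x n s (n - k)" "type_B_x n s (n - 1)"
    by (rule falling_chain_type_B)
  have "(\<lambda>k. type_B_x n s (n - k)) ` {..n} = type_B_x n s ` {..n}"
  proof (intro equalityI subsetI)
    fix a assume "a \<in> type_B_x n s ` {..n}"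
    then obtain j where "j \<le> n" "a = type_B_x n s j" by auto
    then show "a \<in> (\<lambda>k. type_B_x n s (n - k)) ` {..n}"
      by (intro image_eqI[of _ _ "n - j"]) auto
  qed auto
  moreover have "(\<Sum>j\<le>n. qscale (c j) (type_B_x n s j)) = 0 \<Longrightarrow> \<forall>j\<le>n. c j = 0" for c
    using gsum_ascending_independent[of c] by (simp add: type_B_x_eq)
  ultimately show ?thesis
    using span_b_eq family_independentI[of "type_B_x n s" n] by (simp add: family_basis_def)
qed

end

lemma (in falling_chain) algebra_iso_quotient_falling_power:
  "\<exists>\<phi>. algebra_iso_quotient (gen_subalgebra y) (falling_power T (n + 1)) \<phi> \<and>
     \<phi> y = (PIdl\<^bsub>polyQ\<^esub> (falling_power T (n + 1))) +>\<^bsub>polyQ\<^esub> (2 * falling_power T 1)"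
proof -
  let ?A = "ring_of_type_algebra :: ('w \<Rightarrow>\<^sub>0 rat) ring"
  let ?R = "?A\<lparr>carrier := gen_subalgebra y\<rparr>"
  let ?I = "PIdl\<^bsub>polyQ\<^esub> (falling_power T (n + 1))"
  note E = gen_subalgebra_eq_range
  have R: "ring ?R"
  proof (rule ringI)
    show "abelian_group ?R"
    proof (rule abelian_groupI)
      fix a assume "a \<in> carrier ?R"
      then obtain p where "a = poly_eval z p" by (auto simp: E)
      then have "poly_eval z (smult (-1) p) + a = 0"
        by (metis add.left_inverse poly_eval_0 poly_eval_add smult_1_left smult_minus_left)
      then show "\<exists>b\<in>carrier ?R. b \<oplus>\<^bsub>?R\<^esub> a = \<zero>\<^bsub>?R\<^esub>"
        by (auto simp: E ring_of_type_algebra_def)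
    qed (auto simp: E ring_of_type_algebra_def add_ac simp flip: poly_eval_add,
        metis poly_eval_0 rangeI)
    show "monoid ?R"
      by (rule monoidI) (auto simp: E ring_of_type_algebra_def mult.assoc simp flip: poly_eval_mult,
        metis poly_eval_1 rangeI)
  qed (auto simp: ring_of_type_algebra_def distrib_left distrib_right)
  interpret polyQ: cring polyQ by (rule cring_from_type_algebra)
  interpret h: ring_hom_ring polyQ ?R "poly_eval z"
    by (rule ring_hom_ringI[OF polyQ.ring_axioms R])
      (auto simp: E ring_of_type_algebra_def poly_eval_add poly_eval_mult)
  \<comment> \<open>The first isomorphism theorem for evaluation at z: its kernel is generated by
    the minimal polynomial of z. The required map goes from the subalgebra to the quotient, hence
    the inverse of the induced map below.\<close>
  have ker: "a_kernel polyQ ?R (poly_eval z) = ?I"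
    unfolding a_kernel_def' cgenideal_def
    by (auto simp: ring_of_type_algebra_def poly_eval_eq_0_iff dvd_def mult.commute)
  define \<psi> where "\<psi> Y = the_elem (poly_eval z ` Y)" for Y
  have \<psi>: "\<psi> \<in> ring_iso (polyQ Quot ?I) ?R"
    using h.FactRing_iso_set unfolding ker \<psi>_def[abs_def]
    by (auto simp: E ring_of_type_algebra_def)
  have \<psi>_coset: "\<psi> (?I +>\<^bsub>polyQ\<^esub> p) = poly_eval z p" for p
    using h.the_elem_simp[of p] unfolding ker \<psi>_def by (simp add: ring_of_type_algebra_def)
  have coset: "?I +>\<^bsub>polyQ\<^esub> p \<in> carrier (polyQ Quot ?I)" for p
    by (auto simp: FactRing_def A_RCOSETS_def' ring_of_type_algebra_def)
  have Q: "ring (polyQ Quot ?I)"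
    by (rule ideal.quotient_is_ring, rule polyQ.cgenideal_ideal) (simp add: ring_of_type_algebra_def)
  define \<phi> where "\<phi> = inv_into (carrier (polyQ Quot ?I)) \<psi>"
  have iso: "\<phi> \<in> ring_iso ?R (polyQ Quot ?I)"
    unfolding \<phi>_def by (rule ring_iso_set_sym[OF Q \<psi>])
  have \<phi>_poly_eval: "\<phi> (poly_eval z p) = ?I +>\<^bsub>polyQ\<^esub> p" for p
    unfolding \<phi>_def \<psi>_coset[symmetric]
    using \<psi> coset by (intro inv_into_f_f) (auto simp: ring_iso_def bij_betw_def)
  have "\<phi> (qscale c a) = ?I +>\<^bsub>polyQ\<^esub> smult c p"
    if "a \<in> gen_subalgebra y" "\<phi> a = ?I +>\<^bsub>polyQ\<^esub> p" for a c p
  proof -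
    \<comment> \<open>Linearity is demanded for every representative p of the coset; each of them
      evaluates to a.\<close>
    from that(1) obtain q where "a = poly_eval z q" by (auto simp: E)
    with that(2) have "poly_eval z p = a"
      by (metis \<phi>_poly_eval \<psi>_coset)
    then show ?thesis
      by (metis \<phi>_poly_eval poly_eval_smult)
  qed
  with iso have "algebra_iso_quotient (gen_subalgebra y) (falling_power T (n + 1)) \<phi>"
    unfolding algebra_iso_quotient_def by blast
  moreover have "poly_eval z (2 * falling_power T 1) = y"
    by (simp add: falling_power_def z_def qscale_mult_right numeral_poly)
  then have "\<phi> y = ?I +>\<^bsub>polyQ\<^esub> (2 * falling_power T 1)"
    using \<phi>_poly_eval by metis
  ultimately show ?thesis by blast
qed

theorem proposition3p7:
  fixes n :: nat and s :: "nat \<Rightarrow> 'w::group_add"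
  assumes "n \<ge> 2" and "coxeter_system_type_B n s"
  defines "x \<equiv> type_B_x n s"
  defines "E \<equiv> gen_subalgebra (x (n - 1))"
  defines "T \<equiv> [:0, 1:] :: rat poly"
  shows "(\<exists>\<phi>. algebra_iso_quotient E (falling_power T (n + 1)) \<phi> \<and>
           \<phi> (x (n - 1)) =
             (PIdl\<^bsub>polyQ\<^esub> (falling_power T (n + 1))) +>\<^bsub>polyQ\<^esub> (2 * falling_power T 1)) \<and>
         family_basis x n E \<and>
         family_basis (\<lambda>m. x (n - 1) ^ m) n E \<and>
         (\<forall>k\<le>n. x (n - k) =
           (\<Sum>m = 0..k. qscale ((-2) ^ (k - m) * of_nat (stirling k m)) (x (n - 1) ^ m))) \<and>
         (\<forall>k\<le>n. x (n - 1) ^ k =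
           (\<Sum>m = 0..k. qscale (of_nat (Stirling k m) * 2 ^ (k - m)) (x (n - m))))"
proof -
  interpret type_B_system n s
    using assms(1,2) by unfold_locales
  interpret falling_chain n "\<lambda>k. x (n - k)" "x (n - 1)"
    unfolding x_def by (rule falling_chain_type_B)
  show ?thesis
    unfolding E_def T_def atLeast0AtMost
    using algebra_iso_quotient_falling_power family_basis_powers family_basis_type_B_x[folded x_def]
      b_eq_sum_powers power_eq_sum_b
    by blast
qed

end
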